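(* Let $n$ be a positive odd integer. Then \[ \sum_{k=0}^{n-1}[4k+1]\frac{(q;q^2)_k^6}{(q^2;q^2)_k^6}\, q^k \equiv [n]\,q^{(1-n)/2} \sum_{k=0}^{(n-1)/2} \frac{(q;q^2)_k^4}{(q^2;q^2)_k^4}\, q^{2k} \pmod{[n]\Phi_n(q)^2}, \] and \[ \sum_{k=0}^{(n-1)/2}[4k+1]\frac{(q;q^2)_k^6}{(q^2;q^2)_k^6}\, q^k \equiv [n]\,q^{(1-n)/2} \sum_{k=0}^{(n-1)/2} \frac{(q;q^2)_k^4}{(q^2;q^2)_k^4}\, q^{2k} \pmod{[n]\Phi_n(q)^2}. \]
   Context: Here $q$ is an indeterminate. For $x$ and a base $p$ (a power of $q$), $(x;p)_k=\prod_{j=0}^{k-1}(1-xp^j)$ for integers $k\ge 0$. The $q$-integer is $[n]=1+q+\cdots+q^{n-1}$, and $\Phi_n(q)$ is the $n$-th cyclotomic polynomial. For rational functions $A(q),B(q)$ and a polynomial $P(q)$, $A(q)\equiv B(q)\pmod{P(q)}$ means that the numerator of the reduced form of $A(q)-B(q)$ is divisible by $P(q)$ in $\mathbb{Z}[q]$. *)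

theory Defs
  imports Complex_Main "HOL-Computational_Algebra.Computational_Algebra"
begin

definition q_int :: "'a::comm_ring_1 \<Rightarrow> nat \<Rightarrow> 'a" where
  "q_int q n = (\<Sum>i<n. q ^ i)"

definition q_pochhammer :: "'a::comm_ring_1 \<Rightarrow> 'a \<Rightarrow> nat \<Rightarrow> 'a" where
  "q_pochhammer x p k = (\<Prod>j<k. 1 - x * p ^ j)"


definition primitive_roots_unity :: "nat \<Rightarrow> complex set" where
  "primitive_roots_unity n = {z. z ^ n = 1 \<and> (\<forall>m. 0 < m \<and> m < n \<longrightarrow> z ^ m \<noteq> 1)}"

(* The product has integer coefficients for n > 0, so the description is proper;
   see of_int_cyclotomic_poly below. *)
definition cyclotomic_poly :: "nat \<Rightarrow> int poly" where
  "cyclotomic_poly n =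
     (THE p. map_poly of_int p = (\<Prod>z\<in>primitive_roots_unity n. [:- z, 1:]))"


(* The field of rational functions in q is rendered as the fraction field of Z[q]; its
   elements are put in lowest terms over Z[q] by quot_of_fract. *)

definition qX :: "int poly" where
  "qX = [:0, 1:]"

definition qvar :: "int poly fract" where
  "qvar = to_fract qX"

definition ratfun_cong :: "int poly fract \<Rightarrow> int poly fract \<Rightarrow> int poly \<Rightarrow> bool" where
  "ratfun_cong A B P \<longleftrightarrow> P dvd fst (quot_of_fract (A - B))"


lemma of_int_poly_mult:
  "map_poly (of_int :: int \<Rightarrow> complex) (p * q) = map_poly of_int p * map_poly of_int q"
  by (rule poly_eqI) (simp add: coeff_map_poly coeff_mult)

lemma of_int_poly_add:
  "map_poly (of_int :: int \<Rightarrow> complex) (p + q) = map_poly of_int p + map_poly of_int q"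
  by (rule poly_eqI) (simp add: coeff_map_poly)

lemma of_int_poly_inj:
  "map_poly (of_int :: int \<Rightarrow> complex) p = map_poly of_int q \<longleftrightarrow> p = q"
  by (auto simp: poly_eq_iff coeff_map_poly)

lemma of_int_poly_prod:
  "map_poly (of_int :: int \<Rightarrow> complex) (\<Prod>x\<in>A. f x) = (\<Prod>x\<in>A. map_poly of_int (f x))"
  by (induction A rule: infinite_finite_induct) (simp_all add: of_int_poly_mult)

lemma degree_of_int_poly: "degree (map_poly (of_int :: int \<Rightarrow> complex) p) = degree p"
  by (rule degree_map_poly) simp

lemma finite_primitive_roots_unity: "n > 0 \<Longrightarrow> finite (primitive_roots_unity n)"
  by (rule finite_subset[of _ "{z. z ^ n = 1}"])
     (auto simp: primitive_roots_unity_def intro!: finite_roots_unity)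

lemma roots_unity_eq_Union:
  assumes "n > 0"
  shows "{z::complex. z ^ n = 1} = (\<Union>d\<in>{d. d dvd n}. primitive_roots_unity d)"
proof (intro equalityI subsetI)
  fix z :: complex assume "z \<in> {z. z ^ n = 1}"
  hence z: "z ^ n = 1" by simp
  define d where "d = (LEAST d. 0 < d \<and> z ^ d = 1)"
  have d: "0 < d \<and> z ^ d = 1"
    unfolding d_def by (rule LeastI[of _ n]) (use assms z in auto)
  have least: "z ^ m \<noteq> 1" if "0 < m" "m < d" for m
    using that not_less_Least[of m "\<lambda>d. 0 < d \<and> z ^ d = 1"] unfolding d_def by blast
  have "z ^ n = z ^ (d * (n div d) + n mod d)" by simp
  also have "\<dots> = z ^ (n mod d)"
    using d by (simp only: power_add power_mult) simp
  finally have "z ^ (n mod d) = 1" using z by simp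
  hence "n mod d = 0" using least[of "n mod d"] d by auto
  hence "d dvd n" by auto
  thus "z \<in> (\<Union>d\<in>{d. d dvd n}. primitive_roots_unity d)"
    using d least by (auto simp: primitive_roots_unity_def)
next
  fix z assume "z \<in> (\<Union>d\<in>{d. d dvd n}. primitive_roots_unity d)"
  then obtain d where "d dvd n" "z ^ d = 1"
    by (auto simp: primitive_roots_unity_def)
  then obtain k where "n = d * k" by blast
  thus "z \<in> {z. z ^ n = 1}"
    using \<open>z ^ d = 1\<close> by (simp add: power_mult)
qed

lemma primitive_roots_unity_disjoint:
  assumes "d > 0" "e > 0" "d \<noteq> e"
  shows "primitive_roots_unity d \<inter> primitive_roots_unity e = {}"
proof -
  have "d < e \<or> e < d" using assms by auto
  thus ?thesis using assms unfolding primitive_roots_unity_def by blast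
qed

lemma monom_minus_1_decompose:
  assumes "n > 0"
  shows "(monom 1 n - 1 :: complex poly) =
    (\<Prod>d\<in>{d. d dvd n}. \<Prod>z\<in>primitive_roots_unity d. [:- z, 1:])"
proof -
  let ?p = "monom 1 n - 1 :: complex poly"
  have lc: "lead_coeff ?p = 1"
  proof -
    have "degree ?p = n"
      using assms by (intro antisym degree_le le_degree) auto
    thus ?thesis using assms by simp
  qed
  have rsq: "rsquarefree ?p"
    unfolding rsquarefree_roots
  proof (intro allI notI)
    fix a :: complex
    assume a: "poly ?p a = 0 \<and> poly (pderiv ?p) a = 0"
    hence an: "a ^ n = 1" by (simp add: poly_monom)
    hence "a \<noteq> 0" using assms by (auto simp: power_0_left)
    moreover have "of_nat n * a ^ (n - 1) = 0"
      using a by (simp add: pderiv_diff pderiv_monom poly_monom)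
    ultimately show False using assms by simp
  qed
  have "?p = (\<Prod>z | poly ?p z = 0. [:- z, 1:])"
    using complex_poly_decompose_rsquarefree[OF rsq] lc by simp
  also have "{z. poly ?p z = 0} = {z. z ^ n = 1}"
    by (simp add: poly_monom)
  also have "\<dots> = (\<Union>d\<in>{d. d dvd n}. primitive_roots_unity d)"
    by (rule roots_unity_eq_Union[OF assms])
  also have "(\<Prod>z\<in>\<dots>. [:- z, 1:]) =
      (\<Prod>d\<in>{d. d dvd n}. \<Prod>z\<in>primitive_roots_unity d. [:- z, 1:])"
  proof (rule prod.UNION_disjoint)
    show "finite {d. d dvd n}" using assms by simp
    show "\<forall>d\<in>{d. d dvd n}. finite (primitive_roots_unity d)"
      using assms by (auto intro!: finite_primitive_roots_unity intro: dvd_pos_nat)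
    show "\<forall>d\<in>{d. d dvd n}. \<forall>e\<in>{d. d dvd n}. d \<noteq> e \<longrightarrow>
            primitive_roots_unity d \<inter> primitive_roots_unity e = {}"
    proof (intro ballI impI)
      fix d e assume de: "d \<in> {d. d dvd n}" "e \<in> {d. d dvd n}" "d \<noteq> e"
      hence "d > 0" "e > 0" using assms by (auto intro: dvd_pos_nat)
      with de show "primitive_roots_unity d \<inter> primitive_roots_unity e = {}"
        by (intro primitive_roots_unity_disjoint)
    qed
  qed
  finally show ?thesis .
qed

lemma ex_cyclotomic_poly:
  assumes "n > 0"
  shows "\<exists>p. map_poly of_int p = (\<Prod>z\<in>primitive_roots_unity n. [:- z, 1:])"
  using assms
proof (induction n rule: less_induct)
  case (less n)
  let ?C = "\<lambda>n. \<Prod>z\<in>primitive_roots_unity n. [:- z, 1:]"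
  let ?m = "map_poly (of_int :: int \<Rightarrow> complex)"
  let ?D = "{d. d dvd n} - {n}"
  have "\<exists>p. ?m p = ?C d" if "d \<in> ?D" for d
  proof -
    from that have "d dvd n" "d \<noteq> n" by auto
    with less.prems have "0 < d" "d < n"
      using dvd_imp_le[of d n] by (auto simp: dvd_pos_nat)
    thus ?thesis by (intro less.IH)
  qed
  then obtain P where P: "\<And>d. d \<in> ?D \<Longrightarrow> ?m (P d) = ?C d"
    by metis
  define Q where "Q = (\<Prod>d\<in>?D. P d)"
  have mQ: "?m Q = (\<Prod>d\<in>?D. ?C d)"
    unfolding Q_def of_int_poly_prod using P by (intro prod.cong) auto
  have "lead_coeff (?m Q) = 1"
    unfolding mQ by (simp add: lead_coeff_prod)
  hence lcQ: "lead_coeff Q = 1"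
    by (simp add: degree_of_int_poly coeff_map_poly)
  hence Q0: "Q \<noteq> 0" by auto
  obtain A R where AR: "pseudo_divmod (monom 1 n - 1) Q = (A, R)"
    by (cases "pseudo_divmod (monom 1 n - 1) Q")
  have eq: "monom 1 n - 1 = Q * A + R" and R: "R = 0 \<or> degree R < degree Q"
    using pseudo_divmod[OF Q0 AR] lcQ by auto
  have "?m (monom 1 n - 1) = monom 1 n - 1"
    by (rule poly_eqI) (simp add: coeff_map_poly)
  also have "\<dots> = ?C n * ?m Q"
    unfolding mQ using less.prems
    by (subst monom_minus_1_decompose) (auto intro!: prod.remove)
  finally have *: "?C n * ?m Q = ?m Q * ?m A + ?m R"
    unfolding eq of_int_poly_add of_int_poly_mult by simp
  have "?m R = 0"
  proof (rule ccontr)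
    assume nz: "?m R \<noteq> 0"
    have "?m R = ?m Q * (?C n - ?m A)" using * by (simp add: algebra_simps)
    hence "?m Q dvd ?m R" by simp
    hence "degree Q \<le> degree R"
      using dvd_imp_degree_le[of "?m Q" "?m R"] nz by (simp add: degree_of_int_poly)
    with R nz show False by auto
  qed
  with * have "?m Q * ?C n = ?m Q * ?m A" by (simp add: mult.commute)
  moreover have "?m Q \<noteq> 0" using Q0 of_int_poly_inj[of Q 0] by simp
  ultimately have "?m A = ?C n" by simp
  thus ?case by blast
qed

lemma of_int_cyclotomic_poly:
  assumes "n > 0"
  shows "map_poly of_int (cyclotomic_poly n) = (\<Prod>z\<in>primitive_roots_unity n. [:- z, 1:])"
proof -
  obtain p where p: "map_poly of_int p = (\<Prod>z\<in>primitive_roots_unity n. [:- z, 1:])"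
    using ex_cyclotomic_poly[OF assms] by blast
  show ?thesis
    unfolding cyclotomic_poly_def
  proof (rule theI[of _ p])
    show "q = p" if "map_poly of_int q = (\<Prod>z\<in>primitive_roots_unity n. [:- z, 1:])" for q
      using that p of_int_poly_inj[of q p] by simp
  qed (rule p)
qed

end

theory Submission
  imports Defs
begin

text \<open>
  Replace two of the six factors \<open>(q;q\<^sup>2)\<^sub>k / (q\<^sup>2;q\<^sup>2)\<^sub>k\<close> of the left-hand side, and two of the four
  numerator factors \<open>(q;q\<^sup>2)\<^sub>k\<close> of the right-hand side, by versions with parameters \<open>x\<close> and \<open>1/x\<close>. For
  \<open>x = q\<^sup>n\<close> the two sides agree exactly, by a terminating case of Watson's transformation; modulo
  \<open>\<Phi>\<^sub>n(q)\<close> both sides vanish for all \<open>x\<close>, the left one because its terms are antisymmetric under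
  \<open>k \<mapsto> (n-1)/2 - k\<close>. As polynomials in \<open>x + 1/x\<close>, the two specialisations \<open>x = 1\<close> and
  \<open>x = q\<^sup>n\<close> differ by \<open>(1 - q\<^sup>n)\<^sup>2 / q\<^sup>n\<close>, so the congruence at \<open>x = 1\<close> holds modulo \<open>\<Phi>\<^sub>n(q)\<^sup>3\<close>. For the
  remaining cyclotomic factors \<open>\<Phi>\<^sub>d(q)\<close> of \<open>[n]\<close>, the left-hand side splits at a primitive \<open>d\<close>-th root of
  unity into blocks of length \<open>d\<close>, and each block is a multiple of the sum already known to vanish.
\<close>


section \<open>Elementary identities for q-Pochhammer symbols and q-integers\<close>

lemma q_pochhammer_0 [simp]: "q_pochhammer x p 0 = 1"
  by (simp add: q_pochhammer_def)

lemma q_pochhammer_Suc: "q_pochhammer x p (Suc k) = q_pochhammer x p k * (1 - x * p ^ k)"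
  by (simp add: q_pochhammer_def)

lemma q_pochhammer_Suc_shift: "q_pochhammer x p (Suc k) = (1 - x) * q_pochhammer (x * p) p k"
  by (simp del: prod.lessThan_Suc add: q_pochhammer_def prod.lessThan_Suc_shift mult_ac)

lemma q_pochhammer_shift:
  "(1 - x) * q_pochhammer (x * p) p k = q_pochhammer x p k * (1 - x * p ^ k)"
  by (metis q_pochhammer_Suc q_pochhammer_Suc_shift)

lemma q_pochhammer_eq_0: "i < k \<Longrightarrow> x * p ^ i = 1 \<Longrightarrow> q_pochhammer x p k = 0"
  unfolding q_pochhammer_def by (rule prod_zero) auto

lemma q_int_mult: "(1 - q) * q_int q n = 1 - q ^ n"
  by (simp add: q_int_def one_diff_power_eq)

lemma power2_power: "(q^2)^k = (q::'a::comm_monoid_mult)^(2*k)" by (simp add: power_mult)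

lemma square_power: "(q*q)^k = (q::'a::comm_monoid_mult)^(2*k)"
  using power2_power[of q k] by (simp add: power2_eq_square)

section \<open>A terminating case of Watson's transformation\<close>

text \<open>The only factor of the later double sum that couples \<open>k\<close> and
  \<open>j\<close>. The parameter \<open>inverse (q^(2*k))\<close> makes it vanish for
  \<open>j > k\<close>.\<close>

definition pair_poch :: "'a::field \<Rightarrow> nat \<Rightarrow> nat \<Rightarrow> 'a" where
  "pair_poch q k j = q_pochhammer (inverse (q^(2*k))) (q^2) j * q_pochhammer (q^(2*k+1)) (q^2) j"

text \<open>Summand of the balanced 3phi2 series in base q^2 with upper parameters q^(-2k),
  q^(2k+1), q, lower parameters q^2, q^2 and argument q^2.\<close>

definition saal_term :: "'a::field \<Rightarrow> nat \<Rightarrow> nat \<Rightarrow> 'a" where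
  "saal_term q k j = pair_poch q k j * q_pochhammer q (q^2) j / q_pochhammer (q^2) (q^2) j ^ 3 * q^(2*j)"

definition poch_ratio :: "'a::field \<Rightarrow> nat \<Rightarrow> 'a" where
  "poch_ratio q k = q_pochhammer q (q^2) k / q_pochhammer (q^2) (q^2) k"

lemma q_pochhammer_nonzero:
  fixes q :: "'a::field"
  assumes "\<And>i. i > 0 \<Longrightarrow> q ^ i \<noteq> 1"
  shows "q_pochhammer (q^2) (q^2) k \<noteq> 0" "q_pochhammer q (q^2) k \<noteq> 0"
proof -
  have "q^2 * (q^2)^i \<noteq> 1" for i
    using assms[of "2*i+2"] by (simp add: power_mult[symmetric] power_add[symmetric] add.commute)
  thus "q_pochhammer (q^2) (q^2) k \<noteq> 0" by (auto simp: q_pochhammer_def)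
  have "q * (q^2)^i \<noteq> 1" for i
    using assms[of "2*i+1"] by (simp add: power_mult)
  thus "q_pochhammer q (q^2) k \<noteq> 0" by (auto simp: q_pochhammer_def)
qed

lemma pair_poch_eq_0: "q \<noteq> 0 \<Longrightarrow> k < j \<Longrightarrow> pair_poch q k j = 0"
  by (auto simp: pair_poch_def power_mult intro!: q_pochhammer_eq_0[of k])

text \<open>Inductive step for the certificate, with \<open>Q = q^(2*k)\<close> and
  \<open>J = q^(2*j)\<close>. The Pochhammer products \<open>X\<close>, \<open>Y\<close>,
  \<open>a\<close>, \<open>b\<close> factor out and leave a rational identity in \<open>q\<close>,
  \<open>Q\<close>, \<open>J\<close>.\<close>

lemma saal_step:
  fixes q Q J X Y a b :: "'a::field"
  assumes "q \<noteq> 0" "Q \<noteq> 0" "b \<noteq> 0" "1 - q^2*J \<noteq> 0"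
  shows "(1 - q^2*Q)^2 * ((1 - inverse (q^2*Q)) * X * (Y * (1 - q^3*Q*J)) * (a * (1-q*J)) / (b*(1-q^2*J))^3 * (q^2*J))
    - q * (1-q*Q)^2 * (X * (1 - inverse Q * J) * ((1-q*Q) * Y) * (a * (1-q*J)) / (b*(1-q^2*J))^3 * (q^2*J))
    = (1-q^3*Q^2) * (X * (1 - inverse Q * J) * (Y * (1 - q^3*Q*J)) * (a*(1-q*J)*(1-q^3*J)) / (b*(1-q^2*J))^3)
    - (1-q^3*Q^2) * (X * Y * (a*(1-q*J)) / b^3)"
proof -
  let ?d = "1 - q^2*J"
  have *: "X * Y * (a*(1-q*J)) / b^3 = X * Y * (a*(1-q*J)) * ?d^3 / (b*?d)^3"
    using assms by (simp add: power_mult_distrib)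
  have "(1 - q^2*Q)^2 * ((1 - inverse (q^2*Q)) * (1 - q^3*Q*J)  * (q^2*J))
    - q * (1-q*Q)^2 * ((1 - inverse Q * J) * (1-q*Q)  * (q^2*J))
    = (1-q^3*Q^2) * ((1 - inverse Q * J) * (1 - q^3*Q*J) * (1-q^3*J))
    - (1-q^3*Q^2) * ?d^3"
    (is "?A1 - ?A2 = ?A3 - ?A4") using assms by (simp add: field_simps) algebra
  hence "c * ?A1 - c * ?A2 = c * ?A3 - c * ?A4" for c
    by (simp only: right_diff_distrib[symmetric])
  from this[of "X*Y*(a*(1-q*J)) / (b*?d)^3"] show ?thesis
    unfolding * by (simp only: times_divide_eq_left times_divide_eq_right mult_ac)
qed

text \<open>
  Zeilberger's recurrence in \<open>k\<close> for the q-Saalschuetz sum, with its certificate summed up to \<open>j\<close>;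
  the right-hand side vanishes for \<open>j > k\<close>.
\<close>

lemma saal_partial_sum:
  fixes q :: "'a::field"
  assumes q0: "q \<noteq> 0" and q1: "\<And>i. i > 0 \<Longrightarrow> q ^ i \<noteq> 1"
  shows "(\<Sum>i\<le>j. (1 - q^(2*k+2))^2 * saal_term q (Suc k) i - q * (1 - q^(2*k+1))^2 * saal_term q k i)
    = (1 - q^(4*k+3)) * (q_pochhammer (inverse (q^(2*k))) (q^2) j * q_pochhammer (q^(2*k+3)) (q^2) j
        * q_pochhammer q (q^2) (Suc j) / q_pochhammer (q^2) (q^2) j ^ 3)"
proof (induction j)
  case 0
  define Q where "Q = q^k"
  have Q2: "q^(2*k) = Q^2" "q^(4*k) = Q^4"
    by (simp_all add: Q_def power_mult[symmetric] mult.commute)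
  have Q: "q^(2*k+2) = Q^2*q^2" "q^(2*k+1) = Q^2*q" "q^(4*k+3) = Q^4*q^3"
    by (simp_all only: power_add Q2 power_one_right)
  have "(1 - Q^2*q^2)^2 - q * (1 - Q^2*q)^2 = (1 - Q^4*q^3) * (1 - q)" by algebra
  thus ?case
    unfolding Q by (simp add: saal_term_def pair_poch_def q_pochhammer_def)
next
  case (Suc j)
  define Q J where "Q = q^(2*k)" and "J = q^(2*j)"
  define X Y where "X = q_pochhammer (inverse Q) (q^2) j" and "Y = q_pochhammer (q^3*Q) (q^2) j"
  have QJ: "Q \<noteq> 0" "J \<noteq> 0" using q0 by (auto simp: Q_def J_def)
  have d: "1 - q^2*J \<noteq> 0" using q1[of "2*j+2"] by (simp add: J_def power_add power2_eq_square mult_ac)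
  have p4: "q^(4*k+3) = q^3*Q^2" by (simp add: Q_def power_add power_mult[symmetric] mult_ac)
  have p2: "q^(2*k+3) = q^3*Q" "q^(2*Suc k+1) = q^3*Q" "q^(2*k+1) = q*Q" "q^(2*k+2) = q^2*Q" "q^(2*Suc k) = q^2*Q"
     "q^(2*Suc j) = q^2*J"
    by (simp_all add: Q_def J_def power_add mult_ac power2_eq_square power3_eq_cube)
  have X1: "q_pochhammer (inverse (q^2*Q)) (q^2) (Suc j) = (1 - inverse (q^2*Q)) * X"
    using q0 by (simp add: q_pochhammer_Suc_shift X_def mult_ac)
  have X2: "q_pochhammer (inverse Q) (q^2) (Suc j) = X * (1 - inverse Q * J)"
    by (simp add: q_pochhammer_Suc X_def J_def power2_power)
  have Y1: "q_pochhammer (q^3*Q) (q^2) (Suc j) = Y * (1 - q^3*Q*J)"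
    by (simp add: q_pochhammer_Suc Y_def J_def power2_power)
  have Y2: "q_pochhammer (q*Q) (q^2) (Suc j) = (1-q*Q) * Y"
    by (simp add: q_pochhammer_Suc_shift Y_def power3_eq_cube power2_eq_square mult_ac)
  have a1: "q_pochhammer q (q^2) (Suc j) = q_pochhammer q (q^2) j * (1 - q*J)"
    by (simp add: q_pochhammer_Suc J_def power2_power)
  have a2: "q_pochhammer q (q^2) (Suc (Suc j)) = q_pochhammer q (q^2) j * (1 - q*J) * (1 - q^3*J)"
    unfolding q_pochhammer_Suc[of _ _ "Suc j"] a1 by (simp add: J_def square_power power3_eq_cube power2_eq_square mult_ac)
  have b1: "q_pochhammer (q^2) (q^2) (Suc j) = q_pochhammer (q^2) (q^2) j * (1 - q^2*J)"
    by (simp add: q_pochhammer_Suc J_def power2_power)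
  have b: "q_pochhammer (q^2) (q^2) j \<noteq> 0" using q_pochhammer_nonzero[OF q1] by blast
  have h1: "saal_term q (Suc k) (Suc j) = (1 - inverse (q^2*Q)) * X * (Y * (1 - q^3*Q*J)) * (q_pochhammer q (q^2) j * (1-q*J)) / (q_pochhammer (q^2) (q^2) j*(1-q^2*J))^3 * (q^2*J)"
    unfolding saal_term_def pair_poch_def p2 X1 Y1 a1 b1 ..
  have h2: "saal_term q k (Suc j) = X * (1 - inverse Q * J) * ((1-q*Q) * Y) * (q_pochhammer q (q^2) j * (1-q*J)) / (q_pochhammer (q^2) (q^2) j*(1-q^2*J))^3 * (q^2*J)"
    unfolding saal_term_def pair_poch_def p2 Q_def[symmetric] X2 Y2 a1 b1 ..
  show ?case
    unfolding sum.atMost_Suc Suc.IH h1 h2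
    unfolding p2 p4 Q_def[symmetric] X2 Y1 a1 a2 b1
    unfolding saal_step[OF q0 QJ(1) b d]
    by (simp add: X_def Y_def)
qed

text \<open>Summed up to \<open>j = k + 1\<close> the certificate vanishes, which leaves a
  first-order recurrence in \<open>k\<close> that the right-hand side satisfies as well.\<close>

lemma saalschuetz_special:
  fixes q :: "'a::field"
  assumes q0: "q \<noteq> 0" and q1: "\<And>i. i > 0 \<Longrightarrow> q ^ i \<noteq> 1"
  shows "(\<Sum>j\<le>k. saal_term q k j) = poch_ratio q k ^ 2 * q ^ k"
proof (induction k)
  case 0 thus ?case by (simp add: saal_term_def pair_poch_def poch_ratio_def)
next
  case (Suc k)
  let ?A = "1 - q^(2*k+2)" and ?B = "1 - q^(2*k+1)"
  have A: "?A \<noteq> 0" using q1[of "2*k+2"] by simp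
  have z: "q_pochhammer (inverse (q ^ (2 * k))) (q\<^sup>2) (Suc k) = 0"
    using q0 by (intro q_pochhammer_eq_0[of k]) (auto simp: power_mult)
  have z2: "saal_term q k (Suc k) = 0" using pair_poch_eq_0[OF q0, of k "Suc k"] by (simp add: saal_term_def)
  have "?A^2 * (\<Sum>j\<le>Suc k. saal_term q (Suc k) j) - q * ?B^2 * (\<Sum>j\<le>Suc k. saal_term q k j) = 0"
    using saal_partial_sum[OF q0 q1, of k "Suc k"] z by (simp only: sum_subtractf sum_distrib_left) simp
  hence "?A^2 * (\<Sum>j\<le>Suc k. saal_term q (Suc k) j) = q * ?B^2 * (poch_ratio q k ^ 2 * q ^ k)"
    using Suc.IH z2 by simp
  moreover have "poch_ratio q (Suc k) = poch_ratio q k * ?B / ?A"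
    by (simp add: poch_ratio_def q_pochhammer_Suc power2_power power_add[symmetric])
  ultimately have "?A^2 * (\<Sum>j\<le>Suc k. saal_term q (Suc k) j) = ?A^2 * (poch_ratio q (Suc k) ^ 2 * q ^ Suc k)"
    using A by (simp del: sum.atMost_Suc add: power_divide power_mult_distrib)
  thus ?case using A by simp
qed

text \<open>
  For \<open>y = x + 1/x\<close> the polynomial \<open>1 - y q\<^sup>e + q\<^sup>2\<^sup>e\<close> is \<open>(1 - x q\<^sup>e) (1 - q\<^sup>e / x)\<close>. Working with \<open>y\<close>
  instead of the parameter \<open>x\<close> of the creative microscope builds in the symmetry between \<open>x\<close> and \<open>1/x\<close>.
\<close>

definition recip_quad :: "'a::comm_ring_1 \<Rightarrow> 'a \<Rightarrow> nat \<Rightarrow> 'a" where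
  "recip_quad q y e = 1 - y * q ^ e + q ^ (2 * e)"

definition odd_prod :: "'a::comm_ring_1 \<Rightarrow> 'a \<Rightarrow> nat \<Rightarrow> 'a" where
  "odd_prod q y k = (\<Prod>j<k. recip_quad q y (2*j+1))"

definition even_prod :: "'a::comm_ring_1 \<Rightarrow> 'a \<Rightarrow> nat \<Rightarrow> 'a" where
  "even_prod q y k = (\<Prod>j<k. recip_quad q y (2*j+2))"

text \<open>The left-hand summand with parameter \<open>y\<close>, times \<open>1 - q\<close>, but
  without the factor \<open>poch_ratio q k ^ 2 * q^k\<close> that the Saalschuetz sum will
  supply.\<close>

definition wp_weight :: "'a::field \<Rightarrow> 'a \<Rightarrow> nat \<Rightarrow> 'a" where
  "wp_weight q y k = (1 - q^(4*k+1)) * poch_ratio q k ^ 2 * odd_prod q y k / even_prod q y k"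

lemma poch_ratio_Suc: "poch_ratio q (Suc k) = poch_ratio q k * (1 - q^(2*k+1)) / (1 - q^(2*k+2))"
  by (simp add: poch_ratio_def q_pochhammer_Suc power2_power power_add[symmetric])

text \<open>
  A telescoping recurrence in \<open>j\<close>, valid for every \<open>y\<close>. The boundary term \<open>g k\<close> vanishes at \<open>k = 0\<close>,
  and at \<open>k = m + 1\<close> when \<open>y = q\<^sup>n + q\<^sup>-\<^sup>n\<close> with \<open>n = 2m + 1\<close>.
\<close>

lemma well_poised_partial_sum:
  fixes q :: "'a::field" and j :: nat
  assumes q0: "q \<noteq> 0" and q1: "\<And>i. i > 0 \<Longrightarrow> q ^ i \<noteq> 1"
    and ev: "\<And>k. k < N \<Longrightarrow> recip_quad q y (2*k+2) \<noteq> 0"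
    and N: "k \<le> N"
  defines "g \<equiv> \<lambda>k. - (q^2 * (q^(2*j))^2 / q^(2*k)) * (1 - q^(2*k) / q^(2*j)) * (1 - q^(2*k))
     * recip_quad q y (2*k) * pair_poch q k j * poch_ratio q k ^ 2 * odd_prod q y k / even_prod q y k"
  shows "(\<Sum>i<k. wp_weight q y i * (pair_poch q i (Suc j) * (1 - q^(2*j+2)) - pair_poch q i j * (1 - q^(2*j+1)) * recip_quad q y (2*j+1))) = g k"
  using N
proof (induction k)
  case 0 thus ?case by (simp add: g_def)
next
  case (Suc k)
  define Q J where "Q = q^(2*k)" and "J = q^(2*j)"
  have QJ: "Q \<noteq> 0" "J \<noteq> 0" using q0 by (auto simp: Q_def J_def)
  have d: "1 - q^2*Q \<noteq> 0" using q1[of "2*k+2"] by (simp add: Q_def power_add power2_eq_square mult_ac)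
  have d1: "1 - q*Q \<noteq> 0" using q1[of "2*k+1"] by (simp add: Q_def power_add mult.commute)
  have p2: "q^(2*k+1) = q*Q" "q^(2*k+2) = q^2*Q" "q^(2*Suc k) = q^2*Q" "q^(2*Suc k + 1) = q^3*Q"
     "q^(2*Suc j) = q^2*J"  "q^(2*j+2) = q^2*J" "q^(2*j+1) = q*J"
    by (simp_all add: Q_def J_def power_add mult_ac power2_eq_square power3_eq_cube)
  have p4: "q^(4*k+1) = q*Q^2" by (simp add: Q_def power_add power_mult[symmetric] mult_ac)
  define S where "S = pair_poch q k j"
  have S1: "pair_poch q k (Suc j) = S * (1 - J / Q) * (1 - q*Q*J)"
    by (simp add: S_def pair_poch_def q_pochhammer_Suc p2 power2_power Q_def J_def divide_inverse mult_ac)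
  define A B where "A = q_pochhammer (inverse (q^2*Q)) (q^2) j" and "B = q_pochhammer (q^3*Q) (q^2) j"
  have "(1 - inverse (q^2*Q)) * q_pochhammer (inverse (q^2*Q) * q^2) (q^2) j = A * (1 - inverse (q^2*Q) * (q^2)^j)"
    unfolding A_def by (rule q_pochhammer_shift)
  hence A: "(1 - inverse (q^2*Q)) * q_pochhammer (inverse Q) (q^2) j = A * (1 - J / (q^2*Q))"
    using q0 by (simp add: J_def power2_power divide_inverse mult_ac)
  have "(1 - q*Q) * q_pochhammer (q*Q*q^2) (q^2) j = q_pochhammer (q*Q) (q^2) j * (1 - q*Q*(q^2)^j)"
    by (rule q_pochhammer_shift)
  hence B: "(1 - q*Q) * B = q_pochhammer (q*Q) (q^2) j * (1 - q*Q*J)"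
    by (simp add: J_def square_power B_def power2_eq_square power3_eq_cube mult_ac)
  \<comment> \<open>No quotient of the values at \<open>Suc k\<close> and \<open>k\<close> is
    formed, because \<open>1 - J / (q^2*Q)\<close> is zero when \<open>j = k + 1\<close>.\<close>
  have S2: "pair_poch q (Suc k) j * (1 - J / (q^2*Q)) * (1 - q*Q) = S * (1 - inverse (q^2*Q)) * (1 - q*Q*J)"
  proof -
    have "pair_poch q (Suc k) j * (1 - J / (q^2*Q)) * (1 - q*Q) = (A * (1 - J / (q^2*Q))) * ((1 - q*Q) * B)"
      unfolding pair_poch_def p2 A_def B_def by (simp add: mult_ac)
    also have "\<dots> = S * (1 - inverse (q^2*Q)) * (1 - q*Q*J)"
      unfolding A[symmetric] B S_def pair_poch_def p2 Q_def[symmetric] by (simp add: mult_ac)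
    finally show ?thesis .
  qed
  have S3: "pair_poch q (Suc k) j * (1 - q^2*Q/J) * (1 - q*Q) = S * (1 - q^2*Q) / J * (1 - q*Q*J)"
  proof -
    have e1: "1 - q^2*Q/J = - (q^2*Q/J) * (1 - J / (q^2*Q))" using q0 QJ by (simp add: field_simps)
    have e2: "(1 - q^2*Q) / J = - (q^2*Q/J) * (1 - inverse (q^2*Q))" using q0 QJ by (simp add: field_simps)
    have "pair_poch q (Suc k) j * (1 - q^2*Q/J) * (1 - q*Q) = - (q^2*Q/J) * (pair_poch q (Suc k) j * (1 - J / (q^2*Q)) * (1 - q*Q))"
      unfolding e1 by (simp only: mult_ac)
    also have "\<dots> = S * (1 - q^2*Q) / J * (1 - q*Q*J)"
      unfolding S2 times_divide_eq_right[symmetric] e2 by (simp only: mult_ac)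
    finally show ?thesis .
  qed
  define c where "c = poch_ratio q k ^ 2 * odd_prod q y k / even_prod q y k"
  have Ek: "recip_quad q y (2*Suc k) \<noteq> 0" using ev[of k] Suc.prems by simp
  have g1: "g (Suc k) = - (q^2 * J^2 / (q^2*Q)) * (S / J * (1 - q*Q*J)) * (1 - q*Q) * recip_quad q y (2*k+1) * c"
  proof -
    have ev1: "even_prod q y (Suc k) = even_prod q y k * recip_quad q y (2*Suc k)" by (simp add: even_prod_def)
    have od1: "odd_prod q y (Suc k) = odd_prod q y k * recip_quad q y (2*k+1)" by (simp add: odd_prod_def)
    have cr: "poch_ratio q (Suc k)^2 = poch_ratio q k^2 * (1 - q*Q)^2 / (1 - q^2*Q)^2"
      unfolding poch_ratio_Suc p2 by (simp add: power_divide power_mult_distrib)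
    have "g (Suc k) = - (q^2 * J^2 / (q^2*Q)) * (pair_poch q (Suc k) j * (1 - q^2*Q/J) * (1 - q*Q)) * (1 - q*Q) / (1 - q^2*Q) * recip_quad q y (2*k+1) * c"
      unfolding g_def p2 J_def[symmetric] cr ev1 od1 c_def using Ek d
      by (simp add: power2_eq_square)
    thus ?thesis unfolding S3 using d by simp
  qed
  have g0: "g k = - (q^2 * J^2 / Q) * (1 - Q / J) * (1 - Q) * recip_quad q y (2*k) * S * c"
    unfolding g_def p2 J_def[symmetric] Q_def[symmetric] S_def c_def by simp
  have qd: "recip_quad q y (2*k) = 1 - y*Q + Q^2" "recip_quad q y (2*k+1) = 1 - y*q*Q+q^2*Q^2" "recip_quad q y (2*j+1) = 1 - y*q*J+q^2*J^2"
    by (simp_all add: recip_quad_def Q_def J_def power_add mult_ac power2_eq_square mult_2)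
       (simp_all add: power_add[symmetric] mult.commute)
  have w: "wp_weight q y k = (1 - q*Q^2) * c" unfolding wp_weight_def p4 c_def by (simp add: mult_ac)
  \<comment> \<open>The telescoping identity after removal of the common factor
    \<open>S * c\<close>.\<close>
  have key: "(1 - q*Q^2) * ((1 - J / Q) * (1 - q*Q*J) * (1 - q^2*J) - (1 - q*J) * (1 - y*q*J+q^2*J^2))
    = - (q^2 * J^2 / (q^2*Q)) * (1 / J * (1 - q*Q*J)) * (1 - q*Q) * (1 - y*q*Q+q^2*Q^2) - (- (q^2 * J^2 / Q) * (1 - Q / J) * (1 - Q) * (1 - y*Q + Q^2))"
    using q0 QJ by (simp add: field_simps) algebra
  have "wp_weight q y k * (pair_poch q k (Suc j) * (1 - q^(2*j+2)) - pair_poch q k j * (1 - q^(2*j+1)) * recip_quad q y (2*j+1))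
    = S * c * ((1 - q*Q^2) * ((1 - J / Q) * (1 - q*Q*J) * (1 - q^2*J) - (1 - q*J) * (1 - y*q*J+q^2*J^2)))"
  proof -
    have "w * c * (S * a * b * d - S * e * f) = S * c * (w * (a * b * d - e * f))" for w a b d e f
      by algebra
    thus ?thesis unfolding w p2 S1 S_def[symmetric] qd by blast
  qed
  also have "\<dots> = g (Suc k) - g k"
  proof -
    have "S / J = S * (1 / J)" by simp
    moreover have "S * c * (a * (b * d) * e * f - a' * b' * d' * e') =
      a * (S * b * d) * e * f * c - a' * b' * d' * e' * S * c" for a b d e f a' b' d' e' by algebra
    ultimately show ?thesis unfolding key g1 g0 qd by (simp only:)
  qed
  finally show ?case using Suc by simp
qed

section \<open>The specialisation y = q^n + q^(-n)\<close>

lemma recip_quad_factor: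
  fixes q :: "'a::field"
  assumes "q^n * y = q^(2*n) + 1"
  shows "q^n * recip_quad q y e = (q^n - q^e) * (1 - q^(n+e))"
proof -
  have e: "q^(2*n) = (q^n)^2" "q^(2*e) = (q^e)^2" by (simp_all add: power_mult[symmetric] mult.commute)
  have "a * (1 - y * b + b^2) = (a - b) * (1 - a * b)" if "a * y = a^2 + 1" for a b :: 'a
    using that by algebra
  thus ?thesis using assms unfolding recip_quad_def power_add e by blast
qed

text \<open>Both factors in \<open>recip_quad_factor\<close> are nonzero. For odd \<open>n\<close>
  the exception \<open>e = n\<close> never meets the even exponents, which are those in the
  denominators.\<close>

lemma recip_quad_nonzero:
  fixes q :: "'a::field"
  assumes q0: "q \<noteq> 0" and q1: "\<And>i. i > 0 \<Longrightarrow> q ^ i \<noteq> 1"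
    and y: "q^n * y = q^(2*n) + 1" and "e \<noteq> n" "n > 0"
  shows "recip_quad q y e \<noteq> 0"
proof -
  have "q^n \<noteq> q^e"
  proof
    assume eq: "q^n = q^e"
    obtain a b where ab: "b > 0" "q^(a+b) = q^a"
    proof (cases "n < e")
      case True thus ?thesis using that[of "e - n" n] eq by simp
    next
      case False thus ?thesis using that[of "n - e" e] eq \<open>e \<noteq> n\<close> by simp
    qed
    hence "q^a * q^b = q^a * 1" by (simp add: power_add)
    hence "q^b = 1" using q0 by simp
    thus False using q1[OF ab(1)] by simp
  qed
  moreover have "1 - q^(n+e) \<noteq> 0" using q1[of "n+e"] \<open>n > 0\<close> by simp
  ultimately show ?thesis using recip_quad_factor[OF y, of e] by auto
qed

text \<open>Starting value for the downward induction in \<open>well_poised_sum\<close>. The even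
  product splits into \<open>Z * A\<close>; a parameter shift (\<open>F1\<close>) absorbs
  \<open>A\<close>, and reversing the order of factors (\<open>F2\<close>) absorbs
  \<open>Z\<close>.\<close>

lemma well_poised_sum_top:
  fixes q :: "'a::field"
  assumes q0: "q \<noteq> 0" and q1: "\<And>i. i > 0 \<Longrightarrow> q ^ i \<noteq> 1"
    and n: "n = 2*m+1" and y: "q^n * y = q^(2*n) + 1"
  shows "wp_weight q y m * pair_poch q m m = (1 - q^n) / q^m * q_pochhammer q (q^2) m * odd_prod q y m / q_pochhammer (q^2) (q^2) m"
proof -
  define Z where "Z = (\<Prod>j<m. 1 - q^(2*j+2) / q^n)"
  define A where "A = q_pochhammer (q^(2*m+3)) (q^2) m"
  define C where "C = q_pochhammer (q^(2*m+1)) (q^2) m"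
  define B where "B = q_pochhammer (inverse (q^(2*m))) (q^2) m"
  have F1: "(1 - q^(4*m+1)) * C = (1 - q^n) * A"
    using q_pochhammer_shift[of "q^(2*m+1)" "q^2" m]
    by (simp add: C_def A_def n power2_power mult.commute flip: power_add)
      (simp add: power_add mult_ac numeral_eq_Suc)
  have F3: "even_prod q y m = Z * A"
    unfolding even_prod_def Z_def A_def q_pochhammer_def prod.distrib[symmetric]
  proof (intro prod.cong refl)
    fix j assume "j \<in> {..<m}"
    have "q^n * recip_quad q y (2*j+2) = q^n * ((1 - q^(2*j+2)/q^n) * (1 - q^(n + (2*j+2))))"
      unfolding recip_quad_factor[OF y] using q0 by (simp add: field_simps)
    hence "recip_quad q y (2*j+2) = (1 - q^(2*j+2)/q^n) * (1 - q^(n + (2*j+2)))" using q0 by simp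
    moreover have "q^(n + (2*j+2)) = q^(2*m+3) * (q^2)^j"
      by (simp add: n power2_power eval_nat_numeral power_add mult_ac) (simp add: square_power mult_2 power_add)
    ultimately show "recip_quad q y (2*j+2) = (1 - q^(2*j+2)/q^n) * (1 - q^(2*m+3) * (q^2)^j)" by simp
  qed
  have F2: "B * q_pochhammer q (q^2) m = inverse (q^m) * (q_pochhammer (q^2) (q^2) m * Z)"
  proof -
    have "B = (\<Prod>i<m. 1 - inverse (q^(2*m)) * (q^2)^(m - Suc i))"
      unfolding B_def q_pochhammer_def by (rule prod.nat_diff_reindex[symmetric])
    also have "\<dots> = (\<Prod>i<m. 1 - inverse (q^(2*i+2)))"
    proof (intro prod.cong refl)
      fix i assume "i \<in> {..<m}"
      then obtain l where l: "m = Suc i + l" by (auto simp: less_iff_Suc_add)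
      show "1 - inverse (q^(2*m)) * (q^2)^(m - Suc i) = 1 - inverse (q^(2*i+2))"
        using q0 by (simp add: l power2_power power_add field_simps power2_eq_square mult_2_right)
    qed
    finally have B: "B = (\<Prod>i<m. 1 - inverse (q^(2*i+2)))" .
    have "Z = (\<Prod>i<m. 1 - q^(2*(m - Suc i)+2) / q^n)"
      unfolding Z_def by (rule prod.nat_diff_reindex[symmetric])
    also have "\<dots> = (\<Prod>i<m. 1 - inverse (q^(2*i+1)))"
    proof (intro prod.cong refl)
      fix i assume "i \<in> {..<m}"
      then obtain l where l: "m = Suc i + l" by (auto simp: less_iff_Suc_add)
      show "1 - q^(2*(m - Suc i)+2) / q^n = 1 - inverse (q^(2*i+1))"
        using q0 by (simp add: l n power_add field_simps power2_eq_square mult_2_right)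
    qed
    finally have Z: "Z = (\<Prod>i<m. 1 - inverse (q^(2*i+1)))" .
    \<comment> \<open>Spreading q^(-m) over the \<open>m\<close> factors allows a comparison factor
      by factor.\<close>
    have iq: "inverse (q^m) = (\<Prod>i<m. inverse q)" by (simp add: power_inverse)
    show ?thesis
      unfolding B Z iq q_pochhammer_def prod.distrib[symmetric]
    proof (intro prod.cong refl)
      fix i
      show "(1 - inverse (q^(2*i+2))) * (1 - q * (q^2)^i) = inverse q * ((1 - q^2 * (q^2)^i) * (1 - inverse (q^(2*i+1))))"
        using q0 by (simp add: power2_power field_simps power_add power2_eq_square mult_2_right)
    qed
  qed
  have ev: "recip_quad q y (2*k+2) \<noteq> 0" for k
  proof -
    have "2*k+2 \<noteq> n" "n > 0" using n by presburger+
    with recip_quad_nonzero[OF q0 q1 y] show ?thesis by blast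
  qed
  hence evn: "even_prod q y m \<noteq> 0"
    unfolding even_prod_def by simp
  hence ZA: "Z \<noteq> 0" "A \<noteq> 0" unfolding F3 by auto
  define a b where "a = q_pochhammer q (q^2) m" and "b = q_pochhammer (q^2) (q^2) m"
  have ab: "a \<noteq> 0" "b \<noteq> 0" using q_pochhammer_nonzero[OF q1] by (auto simp: a_def b_def)
  have "wp_weight q y m * pair_poch q m m = ((1 - q^(4*m+1)) * C) * (B * a) * a * odd_prod q y m / (b^2 * (Z * A))"
    by (simp add: wp_weight_def pair_poch_def F3 poch_ratio_def a_def b_def C_def B_def power_divide power2_eq_square)
  also have "\<dots> = ((1 - q^n) * A) * (inverse (q^m) * (b * Z)) * a * odd_prod q y m / (b^2 * (Z * A))"
    unfolding F1 F2[folded a_def b_def] ..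
  also have "\<dots> = (1 - q^n) / q^m * a * odd_prod q y m / b"
    using ZA ab q0 by (simp add: power2_eq_square field_simps)
  finally show ?thesis unfolding a_def b_def .
qed

text \<open>Downward induction on \<open>j\<close>. At \<open>j = m\<close> only the term
  \<open>k = m\<close> survives; below, the telescoping recurrence summed over all
  \<open>k \<le> m\<close> relates the sums for \<open>j\<close> and \<open>j + 1\<close>.\<close>

lemma well_poised_sum:
  fixes q :: "'a::field"
  assumes q0: "q \<noteq> 0" and q1: "\<And>i. i > 0 \<Longrightarrow> q ^ i \<noteq> 1"
    and n: "n = 2*m+1" and y: "q^n * y = q^(2*n) + 1" and "j \<le> m"
  shows "(\<Sum>k\<le>m. wp_weight q y k * pair_poch q k j) = (1 - q^n) / q^m * q_pochhammer q (q^2) j * odd_prod q y j / q_pochhammer (q^2) (q^2) j"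
  using \<open>j \<le> m\<close>
proof (induction rule: inc_induct)
  case base
  have "(\<Sum>k\<le>m. wp_weight q y k * pair_poch q k m) = (\<Sum>k\<in>{m}. wp_weight q y k * pair_poch q k m)"
    by (rule sum.mono_neutral_right) (auto simp: pair_poch_eq_0[OF q0])
  thus ?case using well_poised_sum_top[OF q0 q1 n y] by simp
next
  case (step j)
  let ?S = "\<lambda>j. \<Sum>k\<le>m. wp_weight q y k * pair_poch q k j"
  have ev: "recip_quad q y (2*k+2) \<noteq> 0" for k
  proof -
    have "2*k+2 \<noteq> n" "n > 0" using n by presburger+
    with recip_quad_nonzero[OF q0 q1 y] show ?thesis by blast
  qed
  have qj: "recip_quad q y (2*j+1) \<noteq> 0"
    using recip_quad_nonzero[OF q0 q1 y, of "2*j+1"] n step by simp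
  \<comment> \<open>The last factor of \<open>odd_prod q y (Suc m)\<close> has exponent
    \<open>2*m+1 = n\<close>, so the boundary term is zero.\<close>
  have "recip_quad q y n = 0" using recip_quad_factor[OF y, of n] q0 by simp
  hence "odd_prod q y (Suc m) = 0" by (simp add: odd_prod_def n)
  with well_poised_partial_sum[where j = j and k = "Suc m" and N = "Suc m", OF q0 q1 ev order_refl]
  have "(\<Sum>i\<le>m. wp_weight q y i * (pair_poch q i (Suc j) * (1 - q^(2*j+2)) - pair_poch q i j * (1 - q^(2*j+1)) * recip_quad q y (2*j+1))) = 0"
    by (simp add: lessThan_Suc_atMost del: sum.lessThan_Suc)
  hence "?S (Suc j) * (1 - q^(2*j+2)) - ?S j * ((1 - q^(2*j+1)) * recip_quad q y (2*j+1)) = 0"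
    by (simp only: sum_distrib_right sum_subtractf right_diff_distrib[where a = "wp_weight q y i" for i] mult.assoc)
  hence *: "?S j * ((1 - q^(2*j+1)) * recip_quad q y (2*j+1)) = ?S (Suc j) * (1 - q^(2*j+2))" by simp
  have nz: "1 - q^(2*j+1) \<noteq> 0" "1 - q^(2*j+2) \<noteq> 0" using q1[of "2*j+1"] q1[of "2*j+2"] by auto
  have a: "q_pochhammer q (q^2) (Suc j) = q_pochhammer q (q^2) j * (1 - q^(2*j+1))"
    "q_pochhammer (q^2) (q^2) (Suc j) = q_pochhammer (q^2) (q^2) j * (1 - q^(2*j+2))"
    by (simp_all add: q_pochhammer_Suc power2_power power_add[symmetric])
  have o: "odd_prod q y (Suc j) = odd_prod q y j * recip_quad q y (2*j+1)" by (simp add: odd_prod_def)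
  have "?S j * ((1 - q^(2*j+1)) * recip_quad q y (2*j+1)) =
    ((1 - q^n) / q^m * q_pochhammer q (q^2) j * odd_prod q y j / q_pochhammer (q^2) (q^2) j) * ((1 - q^(2*j+1)) * recip_quad q y (2*j+1))"
    unfolding * step.IH a o using nz by simp
  moreover have "(1 - q^(2*j+1)) * recip_quad q y (2*j+1) \<noteq> 0" using nz(1) qj by simp
  ultimately show ?case by (rule mult_right_cancel[THEN iffD1, rotated])
qed

text \<open>Insert the Saalschuetz sum for \<open>poch_ratio q k ^ 2 * q^k\<close>, interchange the
  summations and evaluate the sum over \<open>k\<close> by \<open>well_poised_sum\<close>. The
  factor \<open>1 - q\<close> is carried along to turn q-integers into
  \<open>1 - q^(4*k+1)\<close>.\<close>

lemma watson_special:
  fixes q :: "'a::field"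
  assumes q0: "q \<noteq> 0" and q1: "\<And>i. i > 0 \<Longrightarrow> q ^ i \<noteq> 1"
    and n: "n = 2*m+1" and y: "q^n * y = q^(2*n) + 1"
  shows "(\<Sum>k\<le>m. q_int q (4*k+1) * poch_ratio q k ^ 4 * (odd_prod q y k / even_prod q y k) * q^k)
    = q_int q n / q^m * (\<Sum>k\<le>m. poch_ratio q k ^ 2 * odd_prod q y k / q_pochhammer (q^2) (q^2) k ^ 2 * q^(2*k))"
proof -
  have "(1 - q) * (\<Sum>k\<le>m. q_int q (4*k+1) * poch_ratio q k ^ 4 * (odd_prod q y k / even_prod q y k) * q^k)
    = (\<Sum>k\<le>m. wp_weight q y k * (poch_ratio q k ^ 2 * q^k))"
    unfolding sum_distrib_left mult.assoc[symmetric] q_int_mult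
    by (intro sum.cong refl) (simp add: wp_weight_def numeral_eq_Suc)
  also have "\<dots> = (\<Sum>k\<le>m. wp_weight q y k * (\<Sum>j\<le>m. saal_term q k j))"
  proof (intro sum.cong refl arg_cong2[of _ _ _ _ times])
    fix k assume "k \<in> {..m}"
    have "(\<Sum>j\<le>m. saal_term q k j) = (\<Sum>j\<le>k. saal_term q k j)"
      using \<open>k \<in> {..m}\<close> by (intro sum.mono_neutral_right) (auto simp: saal_term_def pair_poch_eq_0[OF q0])
    thus "poch_ratio q k ^ 2 * q^k = (\<Sum>j\<le>m. saal_term q k j)" using saalschuetz_special[OF q0 q1] by simp
  qed
  also have "\<dots> = (\<Sum>j\<le>m. \<Sum>k\<le>m. wp_weight q y k * saal_term q k j)"
    unfolding sum_distrib_left by (rule sum.swap)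
  also have "\<dots> = (\<Sum>j\<le>m. (\<Sum>k\<le>m. wp_weight q y k * pair_poch q k j) * (q_pochhammer q (q^2) j / q_pochhammer (q^2) (q^2) j ^ 3 * q^(2*j)))"
    unfolding sum_distrib_right by (simp add: saal_term_def mult.assoc)
  also have "\<dots> = (1 - q^n) / q^m * (\<Sum>k\<le>m. poch_ratio q k ^ 2 * odd_prod q y k / q_pochhammer (q^2) (q^2) k ^ 2 * q^(2*k))"
    unfolding sum_distrib_left
  proof (intro sum.cong refl)
    fix j assume "j \<in> {..m}"
    hence "(\<Sum>k\<le>m. wp_weight q y k * pair_poch q k j) = (1 - q^n) / q^m * q_pochhammer q (q^2) j * odd_prod q y j / q_pochhammer (q^2) (q^2) j"
      using well_poised_sum[OF q0 q1 n y] by simp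
    thus "(\<Sum>k\<le>m. wp_weight q y k * pair_poch q k j) * (q_pochhammer q (q^2) j / q_pochhammer (q^2) (q^2) j ^ 3 * q^(2*j))
      = (1 - q^n) / q^m * (poch_ratio q j ^ 2 * odd_prod q y j / q_pochhammer (q^2) (q^2) j ^ 2 * q^(2*j))"
      by (simp only:) (simp add: poch_ratio_def eval_nat_numeral mult_ac)
  qed
  also have "\<dots> = (1 - q) * (q_int q n / q^m * (\<Sum>k\<le>m. poch_ratio q k ^ 2 * odd_prod q y k / q_pochhammer (q^2) (q^2) k ^ 2 * q^(2*k)))"
    by (simp add: q_int_mult[symmetric])
  finally have "(1 - q) * (\<Sum>k\<le>m. q_int q (4*k+1) * poch_ratio q k ^ 4 * (odd_prod q y k / even_prod q y k) * q^k)
    = (1 - q) * (q_int q n / q^m * (\<Sum>k\<le>m. poch_ratio q k ^ 2 * odd_prod q y k / q_pochhammer (q^2) (q^2) k ^ 2 * q^(2*k)))" .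
  moreover have "1 - q \<noteq> 0" using q1[of 1] by simp
  ultimately show ?thesis by (rule mult_left_cancel[THEN iffD1, rotated])
qed

section \<open>Vanishing at primitive roots of unity\<close>

lemma recip_quad_reflect:
  fixes q :: "'a::field"
  assumes "q^n = 1" "e \<le> n"
  shows "q^(2*e) * recip_quad q y (n - e) = recip_quad q y e"
proof -
  have "q^(n-e) * q^e = 1" using assms by (simp add: power_add[symmetric])
  moreover have "q^(2*e) = (q^e)^2" "q^(2*(n-e)) = (q^(n-e))^2" by (simp_all add: power_mult[symmetric] mult.commute)
  moreover have "b^2 * (1 - y * a + a^2) = 1 - y * b + b^2" if "a * b = 1" for a b
    using that by algebra
  ultimately show ?thesis by (simp add: recip_quad_def)
qed

text \<open>Reflecting exponents \<open>e\<close> to \<open>n - e\<close> exchanges odd and even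
  factors up to powers of \<open>q\<close>. For \<open>k = 0\<close> these powers collect to
  \<open>q^(n*m) = 1\<close>; afterwards the quotients of consecutive values at the two ends are
  inverse to each other.\<close>

lemma ratio_reflect:
  fixes q :: "'a::field"
  assumes qn: "q^n = 1" and n: "n = 2*m+1"
    and ev: "\<And>k. k < m \<Longrightarrow> recip_quad q y (2*k+2) \<noteq> 0" and "k \<le> m"
  defines "r \<equiv> \<lambda>k. q^k * odd_prod q y k / even_prod q y k"
  shows "r (m - k) = r k"
proof -
  have q0: "q \<noteq> 0" using qn n by auto
  have rfl: "recip_quad q y (2*j+1) = q^(4*j+2) * recip_quad q y (2*(m - Suc j)+2)" if "j < m" for j
  proof -
    have "n - (2*j+1) = 2*(m - Suc j)+2" using that n by auto
    moreover have "2*j+1 \<le> n" using that n by auto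
    ultimately show ?thesis using recip_quad_reflect[OF qn, of "2*j+1" y] by simp
  qed
  have evm: "even_prod q y m \<noteq> 0" unfolding even_prod_def using ev by simp
  have "odd_prod q y m = (\<Prod>j<m. q^(4*j+2)) * (\<Prod>j<m. recip_quad q y (2*(m - Suc j)+2))"
    unfolding odd_prod_def prod.distrib[symmetric] by (intro prod.cong refl) (use rfl in simp)
  also have "(\<Prod>j<m. recip_quad q y (2*(m - Suc j)+2)) = even_prod q y m"
    unfolding even_prod_def by (rule prod.nat_diff_reindex)
  also have "(\<Prod>j<m. q^(4*j+2)) = q^(2*m*m)"
  proof (induction m)
    case (Suc m)
    have "2 * Suc m * Suc m = 2*m*m + (4*m+2)" by simp
    thus ?case by (simp only: prod.lessThan_Suc Suc.IH power_add[symmetric])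
  qed simp
  finally have "r m = q^(m + 2*m*m)" using evm by (simp add: r_def power_add)
  also have "m + 2*m*m = n * m" by (simp add: n algebra_simps)
  finally have rm: "r m = 1" by (simp add: power_mult qn)
  show ?thesis
    using \<open>k \<le> m\<close>
  proof (induction k)
    case 0
    show ?case using rm by (simp add: r_def odd_prod_def even_prod_def)
  next
    case (Suc k)
    define i where "i = m - Suc k"
    have i: "m - k = Suc i" "m - Suc i = k" "m - Suc k = i" "i < m" "k < m" using Suc.prems by (auto simp: i_def)
    have rS: "r (Suc j) = r j * (q * recip_quad q y (2*j+1) / recip_quad q y (2*j+2))" for j
      by (simp add: r_def odd_prod_def even_prod_def)
    have b: "recip_quad q y (2*i+2) \<noteq> 0" "recip_quad q y (2*k+2) \<noteq> 0" using ev i by auto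
    have a: "recip_quad q y (2*i+1) = q^(4*i+2) * recip_quad q y (2*k+2)" "recip_quad q y (2*k+1) = q^(4*k+2) * recip_quad q y (2*i+2)"
      using rfl[of i] rfl[of k] i by auto
    have "q^(4*i+2) * q^(4*k+2) * q^2 = q^(n*2)"
      unfolding power_add[symmetric] using i n by (intro arg_cong[where f = "\<lambda>j. q^j"]) auto
    hence e: "q^(4*i+2) * q^(4*k+2) * q^2 = 1" by (simp only: power_mult qn) simp
    have *: "r i * (q * recip_quad q y (2*i+1) / recip_quad q y (2*i+2)) = r k"
      using Suc.IH Suc.prems unfolding i rS by simp
    have "r k * (q * recip_quad q y (2*k+1) / recip_quad q y (2*k+2)) = r i * (q^(4*i+2) * q^(4*k+2) * q^2)"
    proof -
      have "z * (q * (B * c) / d) = x * (A * B * q^2)" if "x * (q * (A * d) / c) = z" "c \<noteq> 0" "d \<noteq> 0" for x A B c d z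
        using that(2,3) unfolding that(1)[symmetric] by (simp add: power2_eq_square)
      thus ?thesis using b * unfolding a by blast
    qed
    thus ?case unfolding rS e i by simp
  qed
qed

text \<open>\<open>y = 2\<close> belongs to \<open>x = 1\<close>, where the original Pochhammer
  symbols reappear as squares.\<close>

lemma recip_quad_2: "recip_quad (q::'a::comm_ring_1) 2 e = (1 - q^e)^2"
proof -
  have "q^(2*e) = (q^e)^2" by (simp add: power_mult[symmetric] mult.commute)
  moreover have "1 - 2 * b + b^2 = (1 - b)^2" for b :: 'a by (simp add: power2_eq_square algebra_simps)
  ultimately show ?thesis by (simp add: recip_quad_def)
qed

lemma odd_prod_2: "odd_prod q 2 k = q_pochhammer q (q^2) k ^ 2"
  by (simp add: odd_prod_def recip_quad_2 q_pochhammer_def prod_power_distrib power2_power)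

lemma even_prod_2: "even_prod q 2 k = q_pochhammer (q^2) (q^2) k ^ 2"
  by (simp add: even_prod_def recip_quad_2 q_pochhammer_def prod_power_distrib square_power prod.distrib power2_eq_square mult_ac)

text \<open>Times \<open>1 - q\<close>, each term is a product of symmetric ratios \<open>r\<close>
  and of \<open>(1 - q^(4*k+1)) / q^(2*k)\<close>. The latter changes sign under reflection because
  \<open>q^(2*(m-k)) * q^(2*k) * q = 1\<close>, so the sum equals its own negative.\<close>

lemma half_sum_zero:
  fixes q :: "'a::field_char_0"
  assumes qn: "q^n = 1" and n: "n = 2*m+1" and q1: "\<And>i. 0 < i \<Longrightarrow> i < n \<Longrightarrow> q^i \<noteq> 1" and "m > 0"
    and ev: "\<And>k. k < m \<Longrightarrow> recip_quad q y (2*k+2) \<noteq> 0"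
  shows "(\<Sum>k\<le>m. q_int q (4*k+1) * poch_ratio q k ^ 4 * (odd_prod q y k / even_prod q y k) * q^k) = 0" (is "?S = 0")
proof -
  have q0: "q \<noteq> 0" using qn n by auto
  have q: "1 - q \<noteq> 0" using q1[of 1] n \<open>m > 0\<close> by simp
  define r where "r = (\<lambda>y k. q^k * odd_prod q y k / even_prod q y k)"
  have ev2: "recip_quad q 2 (2*k+2) \<noteq> 0" if "k < m" for k using q1[of "2*k+2"] that n by (simp add: recip_quad_2)
  have r: "r y (m - k) = r y k" "r 2 (m - k) = r 2 k" if "k \<le> m" for k
    unfolding r_def using ratio_reflect[OF qn n ev that] ratio_reflect[OF qn n ev2 that] by auto
  have cr: "poch_ratio q k ^ 4 = (r 2 k / q^k)^2" for k
    using q0 by (simp add: r_def odd_prod_2 even_prod_2 poch_ratio_def power_divide flip: power_mult)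
  define s where "s = (\<lambda>k. (1 - q^(4*k+1)) / q^(2*k) * (r 2 k ^ 2 * r y k))"
  have S: "(1 - q) * ?S = (\<Sum>k\<le>m. s k)"
    unfolding sum_distrib_left mult.assoc[symmetric] q_int_mult
  proof (intro sum.cong refl)
    fix k
    have "(1 - q^(4*k+1)) * poch_ratio q k ^ 4 * (odd_prod q y k / even_prod q y k) * q^k =
      (1 - q^(4*k+1)) * (r 2 k / q^k)^2 * r y k" unfolding cr[symmetric] by (simp add: r_def)
    thus "(1 - q^(4*k+1)) * poch_ratio q k ^ 4 * (odd_prod q y k / even_prod q y k) * q^k = s k"
      unfolding s_def by (simp add: power_divide flip: power_mult) (simp add: mult.commute)
  qed
  have "s (m - k) = - s k" if "k \<le> m" for k
  proof -
    have "(1 - q^(4*(m-k)+1)) / q^(2*(m-k)) = - ((1 - q^(4*k+1)) / q^(2*k))"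
    proof -
      define a b where "a = q^(2*(m-k))" and "b = q^(2*k)"
      have "n = 2*(m-k) + 2*k + 1" using that n by simp
      hence "a * b * q = q^n" unfolding a_def b_def by (simp only: power_add power_one_right)
      hence ab: "a * b * q = 1" using qn by simp
      have e: "q^(4*(m-k)+1) = a^2 * q" "q^(4*k+1) = b^2*q"
        by (simp_all add: a_def b_def power_mult[symmetric] power_add mult_ac)
      moreover have "a \<noteq> 0" "b \<noteq> 0" using q0 by (auto simp: a_def b_def)
      moreover have "(1 - a^2*q) * b = (b^2*q - 1) * a" using ab by algebra
      ultimately show ?thesis unfolding e a_def[symmetric] b_def[symmetric]
        by (simp add: frac_eq_eq minus_divide_left del: minus_divide_left[symmetric])
    qed
    thus ?thesis unfolding s_def r[OF that] by (simp only: mult_minus_left)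
  qed
  hence "(\<Sum>k\<le>m. s (m - k)) = - (\<Sum>k\<le>m. s k)" by (simp add: sum_negf)
  moreover have "(\<Sum>k\<le>m. s (m - k)) = (\<Sum>k\<le>m. s k)"
    using sum.nat_diff_reindex[of s "Suc m"] by (simp only: lessThan_Suc_atMost diff_Suc_Suc)
  ultimately have "(\<Sum>k\<le>m. s k) = 0" by simp
  with S q show ?thesis by simp
qed

lemma half_sum_zero_6:
  fixes q :: "'a::field_char_0"
  assumes qn: "q^n = 1" and n: "n = 2*m+1" and q1: "\<And>i. 0 < i \<Longrightarrow> i < n \<Longrightarrow> q^i \<noteq> 1" and "m > 0"
  shows "(\<Sum>k\<le>m. q_int q (4*k+1) * poch_ratio q k ^ 6 * q^k) = 0"
proof -
  have ev2: "recip_quad q 2 (2*k+2) \<noteq> 0" if "k < m" for k using q1[of "2*k+2"] that n by (simp add: recip_quad_2)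
  have *: "poch_ratio q k ^ 6 = poch_ratio q k ^ 4 * (odd_prod q 2 k / even_prod q 2 k)" for k
  proof -
    have "odd_prod q 2 k / even_prod q 2 k = poch_ratio q k ^ 2" by (simp add: odd_prod_2 even_prod_2 poch_ratio_def power_divide)
    thus ?thesis by (simp flip: power_add)
  qed
  show ?thesis unfolding * using half_sum_zero[OF assms ev2] by (simp add: mult.assoc)
qed

section \<open>Vanishing to third order\<close>

text \<open>For \<open>k \<le> m\<close> the quotient of (q^2;q^2)_m by (q^2;q^2)_k, written without
  division so that it exists over polynomial rings.\<close>

definition poch_tail :: "'a::comm_ring_1 \<Rightarrow> nat \<Rightarrow> nat \<Rightarrow> 'a" where
  "poch_tail q k m = (\<Prod>j\<in>{k..<m}. 1 - q^(2*j+2))"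

text \<open>
  This is \<open>q\<^sup>n\<close> times \<open>recip_quad\<close> at \<open>y = 2 + t/q\<^sup>n\<close>. The scaling makes the critical value \<open>y = q\<^sup>n + q\<^sup>-\<^sup>n\<close>
  correspond to the polynomial \<open>t = (1 - q\<^sup>n)\<^sup>2\<close>, and \<open>y = 2\<close> to \<open>t = 0\<close>.
\<close>

definition scaled_quad :: "nat \<Rightarrow> 'a::comm_ring_1 \<Rightarrow> 'a \<Rightarrow> nat \<Rightarrow> 'a" where
  "scaled_quad n q t e = q^n * (1 - q^e)^2 - t * q^e"

text \<open>The difference of the two sides with parameter, cleared of denominators, so that it can
  be read both over fields and over polynomial rings.\<close>

definition bivar :: "nat \<Rightarrow> nat \<Rightarrow> 'a::comm_ring_1 \<Rightarrow> 'a \<Rightarrow> 'a" where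
  "bivar n m q t =
     q^(n*m+m) * (\<Sum>k\<le>m. q_int q (4*k+1) * q_pochhammer q (q^2) k ^ 4 * poch_tail q k m ^ 4 *
       ((\<Prod>j<k. scaled_quad n q t (2*j+1)) * (\<Prod>j\<in>{k..<m}. scaled_quad n q t (2*j+2))) * q^k)
     - q_int q n * (\<Prod>j<m. scaled_quad n q t (2*j+2)) * (\<Sum>k\<le>m. q_pochhammer q (q^2) k ^ 2 *
        (\<Prod>j<k. scaled_quad n q t (2*j+1)) * q^(n*(m-k)) * poch_tail q k m ^ 4 * q^(2*k))"

text \<open>The difference of the two sides without parameter, times \<open>q^m * W^6\<close>, where
  \<open>N k / W\<close> stands for the Pochhammer ratio. \<open>N\<close> and \<open>W\<close> stay
  abstract because two different common denominators are needed.\<close>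

definition cleared_numer :: "'a::comm_ring_1 \<Rightarrow> nat \<Rightarrow> nat \<Rightarrow> nat \<Rightarrow> (nat \<Rightarrow> 'a) \<Rightarrow> 'a \<Rightarrow> 'a" where
  "cleared_numer q n m M N W = q^m * (\<Sum>k\<le>M. q_int q (4*k+1) * N k ^ 6 * q^k)
     - q_int q n * W^2 * (\<Sum>k\<le>m. N k ^ 4 * q^(2*k))"

lemma prod_lessThan_split:
  fixes f :: "nat \<Rightarrow> 'a::comm_monoid_mult"
  assumes "k \<le> m"
  shows "(\<Prod>j<k. f j) * (\<Prod>j\<in>{k..<m}. f j) = (\<Prod>j<m. f j)"
  using assms by (metis atLeast0LessThan prod.atLeastLessThan_concat zero_le)

lemma q_pochhammer_poch_tail:
  assumes "k \<le> m"
  shows "q_pochhammer (q^2) (q^2) k * poch_tail q k m = q_pochhammer (q^2) (q^2) m"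
  unfolding q_pochhammer_def poch_tail_def using prod_lessThan_split[OF assms, of "\<lambda>j. 1 - q^(2*j+2)"]
  by (simp add: square_power power2_eq_square mult_ac)

lemma bivar_field:
  fixes q :: "'a::field"
  assumes q0: "q \<noteq> 0" and p: "q_pochhammer (q^2) (q^2) m \<noteq> 0"
    and y: "y = 2 + t / q^n" and ev: "\<And>k. k < m \<Longrightarrow> recip_quad q y (2*k+2) \<noteq> 0"
  shows "bivar n m q t = q^(n*m+m) * q_pochhammer (q^2) (q^2) m ^ 4 * (q^(n*m) * even_prod q y m) *
    ((\<Sum>k\<le>m. q_int q (4*k+1) * poch_ratio q k ^ 4 * (odd_prod q y k / even_prod q y k) * q^k)
    - q_int q n / q^m * (\<Sum>k\<le>m. poch_ratio q k ^ 2 * odd_prod q y k / q_pochhammer (q^2) (q^2) k ^ 2 * q^(2*k)))"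
proof -
  let ?p = "q_pochhammer (q^2) (q^2)"
  have sq: "scaled_quad n q t e = q^n * recip_quad q y e" for e
  proof -
    have "q^(2*e) = (q^e)^2" by (simp add: power_mult[symmetric] mult.commute)
    thus ?thesis using q0 by (simp add: scaled_quad_def recip_quad_def y power2_eq_square field_simps)
  qed
  have od: "(\<Prod>j<k. scaled_quad n q t (2*j+1)) = q^(n*k) * odd_prod q y k" for k
    by (simp add: sq odd_prod_def prod.distrib power_mult)
  have evm: "even_prod q y k \<noteq> 0" if "k \<le> m" for k unfolding even_prod_def using ev that by simp
  have et: "(\<Prod>j\<in>{k..<m}. scaled_quad n q t (2*j+2)) = q^(n*(m-k)) * (even_prod q y m / even_prod q y k)" if "k \<le> m" for k
  proof -
    have "even_prod q y k * (\<Prod>j\<in>{k..<m}. recip_quad q y (2*j+2)) = even_prod q y m"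
      unfolding even_prod_def by (rule prod_lessThan_split[OF that])
    thus ?thesis using evm[OF that] by (simp add: sq prod.distrib power_mult field_simps)
  qed
  have e0: "(\<Prod>j<m. scaled_quad n q t (2*j+2)) = q^(n*m) * even_prod q y m"
    using et[of 0] by (simp add: atLeast0LessThan even_prod_def)
  have pk: "?p k \<noteq> 0" if "k \<le> m" for k using q_pochhammer_poch_tail[OF that, of q] p by auto
  have tl: "poch_tail q k m = ?p m / ?p k" if "k \<le> m" for k
    using q_pochhammer_poch_tail[OF that, of q] pk[OF that] by (simp add: field_simps)
  have nk: "q^(n*k) * q^(n*(m-k)) = q^(n*m)" if "k \<le> m" for k
    using that by (simp add: power_add[symmetric] distrib_left[symmetric])
  have 1: "(\<Sum>k\<le>m. q_int q (4*k+1) * q_pochhammer q (q^2) k ^ 4 * poch_tail q k m ^ 4 *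
       ((\<Prod>j<k. scaled_quad n q t (2*j+1)) * (\<Prod>j\<in>{k..<m}. scaled_quad n q t (2*j+2))) * q^k)
    = ?p m ^ 4 * (q^(n*m) * even_prod q y m) * (\<Sum>k\<le>m. q_int q (4*k+1) * poch_ratio q k ^ 4 * (odd_prod q y k / even_prod q y k) * q^k)"
    unfolding sum_distrib_left
  proof (intro sum.cong refl)
    fix k assume "k \<in> {..m}"
    hence k: "k \<le> m" by simp
    have "q_int q (4*k+1) * q_pochhammer q (q^2) k ^ 4 * poch_tail q k m ^ 4 *
       ((\<Prod>j<k. scaled_quad n q t (2*j+1)) * (\<Prod>j\<in>{k..<m}. scaled_quad n q t (2*j+2))) * q^k
      = (q^(n*k) * q^(n*(m-k))) * (q_int q (4*k+1) * q_pochhammer q (q^2) k ^ 4 * (?p m / ?p k) ^ 4 *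
       (odd_prod q y k * (even_prod q y m / even_prod q y k)) * q^k)"
      unfolding od et[OF k] tl[OF k] by (simp only: mult_ac)
    also have "\<dots> = ?p m ^ 4 * (q^(n*m) * even_prod q y m) * (q_int q (4*k+1) * poch_ratio q k ^ 4 * (odd_prod q y k / even_prod q y k) * q^k)"
      unfolding nk[OF k] poch_ratio_def by (simp add: power_divide)
    finally show "q_int q (4*k+1) * q_pochhammer q (q^2) k ^ 4 * poch_tail q k m ^ 4 *
       ((\<Prod>j<k. scaled_quad n q t (2*j+1)) * (\<Prod>j\<in>{k..<m}. scaled_quad n q t (2*j+2))) * q^k
      = ?p m ^ 4 * (q^(n*m) * even_prod q y m) * (q_int q (4*k+1) * poch_ratio q k ^ 4 * (odd_prod q y k / even_prod q y k) * q^k)" .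
  qed
  have 2: "(\<Sum>k\<le>m. q_pochhammer q (q^2) k ^ 2 *
        (\<Prod>j<k. scaled_quad n q t (2*j+1)) * q^(n*(m-k)) * poch_tail q k m ^ 4 * q^(2*k))
    = ?p m ^ 4 * q^(n*m) * (\<Sum>k\<le>m. poch_ratio q k ^ 2 * odd_prod q y k / ?p k ^ 2 * q^(2*k))"
    unfolding sum_distrib_left
  proof (intro sum.cong refl)
    fix k assume "k \<in> {..m}"
    hence k: "k \<le> m" by simp
    have "q_pochhammer q (q^2) k ^ 2 * (\<Prod>j<k. scaled_quad n q t (2*j+1)) * q^(n*(m-k)) * poch_tail q k m ^ 4 * q^(2*k)
      = (q^(n*k) * q^(n*(m-k))) * (q_pochhammer q (q^2) k ^ 2 * odd_prod q y k * (?p m / ?p k) ^ 4 * q^(2*k))"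
      unfolding od tl[OF k] by (simp only: mult_ac)
    also have "\<dots> = ?p m ^ 4 * q^(n*m) * (poch_ratio q k ^ 2 * odd_prod q y k / ?p k ^ 2 * q^(2*k))"

    proof -
      have "x^4 = x^2 * x^2" for x :: 'a by (simp flip: power_add)
      thus ?thesis unfolding nk[OF k] poch_ratio_def by (simp add: power_divide mult_ac)
    qed
    finally show "q_pochhammer q (q^2) k ^ 2 * (\<Prod>j<k. scaled_quad n q t (2*j+1)) * q^(n*(m-k)) * poch_tail q k m ^ 4 * q^(2*k)
      = ?p m ^ 4 * q^(n*m) * (poch_ratio q k ^ 2 * odd_prod q y k / ?p k ^ 2 * q^(2*k))" .
  qed
  have 3: "a * (p4 * e * S1) - i * e * (p4 * nm * S2) = a * p4 * e * (S1 - i / qm * S2)"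
    if "a = nm * qm" "qm \<noteq> 0" for a p4 e S1 S2 nm i qm :: 'a
    unfolding that(1) using that(2) by (simp add: field_simps)
  show ?thesis
    unfolding bivar_def 1 2 e0 by (rule 3) (use q0 in \<open>simp_all add: power_add\<close>)
qed

lemma bivar_generic:
  fixes q :: "'a::field"
  assumes q0: "q \<noteq> 0" and q1: "\<And>i. i > 0 \<Longrightarrow> q ^ i \<noteq> 1" and n: "n = 2*m+1"
  shows "bivar n m q ((1 - q^n)^2) = 0"
proof -
  define y where "y = 2 + (1 - q^n)^2 / q^n"
  have y: "q^n * y = q^(2*n) + 1"
  proof -
    have "q^(2*n) = (q^n)^2" by (simp add: power_mult[symmetric] mult.commute)
    thus ?thesis using q0 by (simp add: y_def field_simps power2_eq_square)
  qed
  have "recip_quad q y (2*k+2) \<noteq> 0" for k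
  proof -
    have "2*k+2 \<noteq> n" "n > 0" using n by presburger+
    with recip_quad_nonzero[OF q0 q1 y] show ?thesis by blast
  qed
  from bivar_field[OF q0 q_pochhammer_nonzero(1)[OF q1] y_def this] watson_special[OF q0 q1 n y]
  show ?thesis by simp
qed

text \<open>The left part vanishes by \<open>half_sum_zero\<close>, the right part because [n] = 0.
  The excluded \<open>t\<close> are those at which a denominator is zero; they are finitely many, so
  a polynomial in \<open>t\<close> is still forced to vanish.\<close>

lemma bivar_root:
  fixes q :: "'a::field_char_0"
  assumes qn: "q^n = 1" and n: "n = 2*m+1" and q1: "\<And>i. 0 < i \<Longrightarrow> i < n \<Longrightarrow> q^i \<noteq> 1" and "m > 0"
    and t: "t \<notin> (\<lambda>k. (1 - q^(2*k+2))^2 / q^(2*k+2)) ` {..<m}"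
  shows "bivar n m q t = 0"
proof -
  have q0: "q \<noteq> 0" using qn n by auto
  have "1 - q \<noteq> 0" using q1[of 1] n \<open>m > 0\<close> by simp
  moreover have "(1 - q) * q_int q n = 0" by (simp only: q_int_mult qn) simp
  ultimately have qi: "q_int q n = 0" by simp
  have p: "q_pochhammer (q^2) (q^2) m \<noteq> 0"
  proof -
    have "q^2 * (q^2)^i \<noteq> 1" if "i < m" for i
    proof -
      have "q^2 * (q^2)^i = q^(2*i+2)" by (simp add: square_power power2_eq_square)
      thus ?thesis using q1[of "2*i+2"] that n by simp
    qed
    thus ?thesis by (auto simp: q_pochhammer_def)
  qed
  have ev: "recip_quad q (2 + t / q^n) (2*k+2) \<noteq> 0" if "k < m" for k
  proof
    obtain e where e: "e = 2*k+2" by simp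
    assume "recip_quad q (2 + t / q^n) (2*k+2) = 0"
    hence "recip_quad q (2 + t / q^n) e = 0" by (simp only: e)
    hence "1 - (2 + t) * q^e + (q^e)^2 = 0" by (simp add: recip_quad_def qn power_mult[symmetric] mult.commute)
    moreover have "(1 - b)^2 = t * b" if "1 - (2 + t) * b + b^2 = 0" for b using that by algebra
    ultimately have "(1 - q^e)^2 = t * q^e" by blast
    hence "t = (1 - q^e)^2 / q^e" using q0 by (simp add: field_simps)
    with t that show False by (auto simp: e)
  qed
  show ?thesis
    using bivar_field[OF q0 p refl ev] half_sum_zero[OF qn n q1 \<open>m > 0\<close> ev] qi by simp
qed

lemma bivar_0:
  "bivar n m q 0 = q^(2*n*m) * cleared_numer q n m m (\<lambda>k. q_pochhammer q (q^2) k * poch_tail q k m) (q_pochhammer (q^2) (q^2) m)"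
proof -
  have sq: "scaled_quad n q 0 e = q^n * (1 - q^e)^2" for e by (simp add: scaled_quad_def)
  have od: "(\<Prod>j<k. scaled_quad n q 0 (2*j+1)) = q^(n*k) * q_pochhammer q (q^2) k ^ 2" for k
    by (simp add: sq q_pochhammer_def prod.distrib power_mult[of q n] power2_power prod_power_distrib)
  have et: "(\<Prod>j\<in>{k..<l}. scaled_quad n q 0 (2*j+2)) = q^(n*(l-k)) * poch_tail q k l ^ 2" for k l
    by (simp add: sq poch_tail_def prod.distrib power_mult[of q n] prod_power_distrib)
  have e0: "(\<Prod>j<m. scaled_quad n q 0 (2*j+2)) = q^(n*m) * q_pochhammer (q^2) (q^2) m ^ 2"
    using et[of 0 m] q_pochhammer_poch_tail[of 0 m q] by (simp add: atLeast0LessThan)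
  have nk: "q^(n*k) * q^(n*(m-k)) = q^(n*m)" if "k \<le> m" for k
    using that by (simp add: power_add[symmetric] distrib_left[symmetric])
  have 1: "(\<Sum>k\<le>m. q_int q (4*k+1) * q_pochhammer q (q^2) k ^ 4 * poch_tail q k m ^ 4 *
       ((\<Prod>j<k. scaled_quad n q 0 (2*j+1)) * (\<Prod>j\<in>{k..<m}. scaled_quad n q 0 (2*j+2))) * q^k)
    = q^(n*m) * (\<Sum>k\<le>m. q_int q (4*k+1) * (q_pochhammer q (q^2) k * poch_tail q k m) ^ 6 * q^k)"
    unfolding sum_distrib_left
  proof (intro sum.cong refl)
    fix k assume "k \<in> {..m}"
    hence k: "k \<le> m" by simp
    have "a * P^4 * T^4 * ((b * P^2) * (c * T^2)) * d = (b * c) * (a * (P * T)^6 * d)" for a b c d P T :: 'a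
      by (simp add: power_mult_distrib eval_nat_numeral mult_ac)
    thus "q_int q (4*k+1) * q_pochhammer q (q^2) k ^ 4 * poch_tail q k m ^ 4 *
       ((\<Prod>j<k. scaled_quad n q 0 (2*j+1)) * (\<Prod>j\<in>{k..<m}. scaled_quad n q 0 (2*j+2))) * q^k
      = q^(n*m) * (q_int q (4*k+1) * (q_pochhammer q (q^2) k * poch_tail q k m) ^ 6 * q^k)"
      unfolding od et nk[OF k, symmetric] by blast
  qed
  have 2: "(\<Sum>k\<le>m. q_pochhammer q (q^2) k ^ 2 *
        (\<Prod>j<k. scaled_quad n q 0 (2*j+1)) * q^(n*(m-k)) * poch_tail q k m ^ 4 * q^(2*k))
    = q^(n*m) * (\<Sum>k\<le>m. (q_pochhammer q (q^2) k * poch_tail q k m) ^ 4 * q^(2*k))"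
    unfolding sum_distrib_left
  proof (intro sum.cong refl)
    fix k assume "k \<in> {..m}"
    hence k: "k \<le> m" by simp
    have "P^2 * (b * P^2) * c * T^4 * d = (b * c) * ((P * T)^4 * d)" for b c d P T :: 'a
      by (simp add: power_mult_distrib eval_nat_numeral mult_ac)
    thus "q_pochhammer q (q^2) k ^ 2 * (\<Prod>j<k. scaled_quad n q 0 (2*j+1)) * q^(n*(m-k)) * poch_tail q k m ^ 4 * q^(2*k)
      = q^(n*m) * ((q_pochhammer q (q^2) k * poch_tail q k m) ^ 4 * q^(2*k))"
      unfolding od nk[OF k, symmetric] by blast
  qed
  have 3: "nm * qm * (nm * S1) - i * (nm * W) * (nm * S2) = nm^2 * (qm * S1 - i * W * S2)"
    for nm qm S1 S2 i W :: 'a by (simp add: algebra_simps power2_eq_square)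
  have "q^(2*n*m) = (q^(n*m))^2" by (simp add: power_mult[symmetric] mult_ac)
  thus ?thesis unfolding bivar_def cleared_numer_def 1 2 e0 power_add by (simp only: 3)
qed

text \<open>In the application the outer variable is \<open>t\<close> and the inner one
  \<open>q\<close>; the two evaluations commute.\<close>

lemma poly_map_poly_eval: "poly (map_poly (\<lambda>c. poly c z) p) a = poly (poly p [:a:]) (z :: 'a::idom)"
  by (induction p) (simp_all add: map_poly_pCons)

lemma infinite_non_roots_of_unity: "infinite {z::complex. z \<noteq> 0 \<and> (\<forall>i>0. z^i \<noteq> 1)}"
proof (rule infinite_super)
  show "infinite (of_nat ` {2..} :: complex set)"
    by (subst finite_image_iff) (auto simp: infinite_Ici inj_on_def)
  have "(of_nat k :: complex) ^ i \<noteq> 1" if "k \<ge> 2" "i > 0" for k i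
  proof -
    have "k ^ i \<noteq> 1" using that by simp
    hence "of_nat (k ^ i) \<noteq> (1::complex)" by (metis of_nat_1 of_nat_eq_iff)
    thus ?thesis by simp
  qed
  thus "of_nat ` {2..} \<subseteq> {z::complex. z \<noteq> 0 \<and> (\<forall>i>0. z^i \<noteq> 1)}" by auto
qed

lemma poly_eqI_infinite:
  assumes "infinite A" "\<And>z. z \<in> A \<Longrightarrow> poly p z = 0"
  shows "p = (0 :: 'a::idom poly)"
proof (rule ccontr)
  assume "p \<noteq> 0"
  hence "finite {z. poly p z = 0}" by (rule poly_roots_finite)
  moreover have "A \<subseteq> {z. poly p z = 0}" using assms(2) by auto
  ultimately show False using assms(1) finite_subset by blast
qed

lemma poly_q_int: "poly (q_int q n) a = q_int (poly q a) n"
  by (simp add: q_int_def poly_sum)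

lemma poly_q_pochhammer: "poly (q_pochhammer x p k) a = q_pochhammer (poly x a) (poly p a) k"
  by (simp add: q_pochhammer_def poly_prod)

lemma poly_poch_tail: "poly (poch_tail q k m) a = poch_tail (poly q a) k m"
  by (simp add: poch_tail_def poly_prod del: power_Suc)

lemma poly_scaled_quad: "poly (scaled_quad n q t e) a = scaled_quad n (poly q a) (poly t a) e"
  by (simp add: scaled_quad_def)

lemma poly_bivar: "poly (bivar n m q t) a = bivar n m (poly q a) (poly t a)"
  by (simp add: bivar_def poly_sum poly_prod poly_q_int poly_q_pochhammer poly_poch_tail poly_scaled_quad del: power_Suc)

text \<open>
  Every coefficient of the polynomial in \<open>t\<close> is divisible by \<open>q - z\<close>, and it vanishes at \<open>t = (1 - q\<^sup>n)\<^sup>2\<close>,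
  which is divisible by \<open>(q - z)\<^sup>2\<close>. Hence its constant term is divisible by \<open>(q - z)\<^sup>3\<close>.
\<close>

lemma bivar_cubic_root:
  fixes z :: complex
  assumes zn: "z^n = 1" and n: "n = 2*m+1" and z1: "\<And>i. 0 < i \<Longrightarrow> i < n \<Longrightarrow> z^i \<noteq> 1" and "m > 0"
  shows "[:-z,1:]^3 dvd bivar n m [:0,1:] 0"
proof -
  define X where "X = [:0, 1::complex:]"
  \<comment> \<open>\<open>[:X:]\<close> is \<open>q\<close> as a constant, and
    \<open>[:0,1:]\<close> is the variable \<open>t\<close>.\<close>
  define F where "F = bivar n m [:X:] [:0,1:]"
  have F: "poly F g = bivar n m X g" for g
    by (simp add: F_def poly_bivar)
  have FX: "poly (bivar n m X g) a = bivar n m a (poly g a)" for g a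
    by (simp add: X_def poly_bivar)
  let ?f = "map_poly (\<lambda>c. poly c z) F"
  have "?f = 0"
  proof (rule poly_eqI_infinite)
    show "infinite (- (\<lambda>k. (1 - z^(2*k+2))^2 / z^(2*k+2)) ` {..<m})"
      unfolding Compl_eq_Diff_UNIV by (intro Diff_infinite_finite infinite_UNIV_char_0) simp
    show "poly ?f a = 0" if "a \<in> - (\<lambda>k. (1 - z^(2*k+2))^2 / z^(2*k+2)) ` {..<m}" for a
      using bivar_root[OF zn n z1 \<open>m > 0\<close>, of a] that by (simp add: poly_map_poly_eval F FX)
  qed
  hence "coeff ?f i = 0" for i by simp
  hence "poly (coeff F i) z = 0" for i by (simp add: coeff_map_poly)
  hence dvd: "[:-z,1:] dvd coeff F i" for i by (simp add: poly_eq_0_iff_dvd)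
  \<comment> \<open>The constant term \<open>c\<close> is the value at \<open>t = 0\<close>; the
    root \<open>g\<close> expresses it as \<open>- (g * poly H g)\<close>, and the coefficients of
    \<open>H\<close> are among those of \<open>F\<close>.\<close>
  obtain c H where cH: "F = pCons c H" by (cases F)
  define g where "g = (1 - X^n)^2"
  have "bivar n m X g = 0"
  proof (rule poly_eqI_infinite[OF infinite_non_roots_of_unity])
    fix a :: complex assume "a \<in> {a. a \<noteq> 0 \<and> (\<forall>i>0. a^i \<noteq> 1)}"
    thus "poly (bivar n m X g) a = 0"
      unfolding FX using bivar_generic[OF _ _ n, of a] by (simp add: g_def X_def)
  qed
  hence "c = - (g * poly H g)" using F[of g] by (simp add: cH eq_neg_iff_add_eq_0)
  moreover have "[:-z,1:]^2 dvd g"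
    unfolding g_def by (rule dvd_power_same) (unfold poly_eq_0_iff_dvd[symmetric], simp add: X_def zn)
  moreover have "[:-z,1:] dvd poly H g"
    unfolding poly_altdef using dvd[of "Suc _"] by (intro dvd_sum dvd_mult2) (simp add: cH)
  ultimately have "[:-z,1:]^2 * [:-z,1:] dvd c" by (metis dvd_minus_iff mult_dvd_mono)
  moreover have "c = bivar n m X 0" using F[of 0] by (simp add: cH)
  moreover have "p^3 = p^2 * p" for p :: "complex poly" by (simp add: power2_eq_square power3_eq_cube)
  ultimately show ?thesis by (simp only: X_def)
qed

section \<open>Factorisation over blocks\<close>

text \<open>The Gaussian binomial coefficient of \<open>k + l\<close> over \<open>k\<close>, given
  by the q-Pascal rule and not as a quotient, so that it has a value at roots of unity.\<close>

fun q_binom :: "'a::comm_ring_1 \<Rightarrow> nat \<Rightarrow> nat \<Rightarrow> 'a" where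
  "q_binom q 0 l = 1"
| "q_binom q (Suc k) 0 = 1"
| "q_binom q (Suc k) (Suc l) = q_binom q k (Suc l) + q ^ Suc k * q_binom q (Suc k) l"

definition neg_poch :: "'a::comm_ring_1 \<Rightarrow> nat \<Rightarrow> 'a" where
  "neg_poch q k = (\<Prod>j<k. 1 + q ^ Suc j)"

lemma q_pochhammer_q_Suc: "q_pochhammer q q (Suc k) = q_pochhammer q q k * (1 - q ^ Suc k)"
  by (simp add: q_pochhammer_Suc)

lemma q_binom_pochhammer:
  "q_binom q k l * q_pochhammer q q k * q_pochhammer q q l = q_pochhammer q q (k + l)"
proof (induction q k l rule: q_binom.induct)
  case (3 q k l)
  let ?p = "q_pochhammer q q"
  have "q_binom q (Suc k) (Suc l) * ?p (Suc k) * ?p (Suc l) =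
    (q_binom q k (Suc l) * ?p k * ?p (Suc l)) * (1 - q ^ Suc k) +
    q ^ Suc k * ((q_binom q (Suc k) l * ?p (Suc k) * ?p l) * (1 - q ^ Suc l))"
    unfolding q_binom.simps(3) distrib_right q_pochhammer_q_Suc by (simp only: mult_ac)
  also have "\<dots> = ?p (Suc (k + l)) * ((1 - q ^ Suc k) + q ^ Suc k * (1 - q ^ Suc l))"
    unfolding 3 by (simp add: algebra_simps)
  also have "(1 - q ^ Suc k) + q ^ Suc k * (1 - q ^ Suc l) = 1 - q ^ Suc (Suc (k + l))"
    by (simp add: algebra_simps power_add)
  finally show ?case by (simp add: q_pochhammer_q_Suc[of q "Suc (k+l)"])
qed simp_all

lemma q_pochhammer_double:
  "q_pochhammer q q (2*k) = q_pochhammer q (q^2) k * q_pochhammer (q^2) (q^2) k"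
proof (induction k)
  case (Suc k)
  have "q_pochhammer q q (2 * Suc k) = q_pochhammer q q (2*k) * (1 - q^(2*k+1)) * (1 - q^(2*k+2))"
    using q_pochhammer_q_Suc[of q "2*k"] q_pochhammer_q_Suc[of q "Suc (2*k)"] by simp
  thus ?case unfolding Suc.IH q_pochhammer_Suc by (simp add: square_power power2_eq_square mult_ac)
qed simp

lemma q_pochhammer_square: "q_pochhammer (q^2) (q^2) k = q_pochhammer q q k * neg_poch q k"
proof (induction k)
  case (Suc k)
  have "1 - q^2 * (q^2)^k = (1 - q ^ Suc k) * (1 + q ^ Suc k)"
    by (simp add: algebra_simps power2_eq_square power_mult_distrib)
  thus ?case unfolding q_pochhammer_Suc[of "q^2"] q_pochhammer_q_Suc[of q] neg_poch_def prod.lessThan_Suc Suc.IH[unfolded neg_poch_def]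
    by (simp only: mult_ac)
qed (simp add: neg_poch_def)

text \<open>Comes from splitting \<open>q_pochhammer q q (2*k)\<close> into odd and even exponents.
  It rewrites the Pochhammer ratio with denominator \<open>neg_poch q k ^ 2\<close>, which has no
  zeros at roots of unity of odd order.\<close>

lemma q_binom_central:
  fixes q :: "'a::idom"
  assumes "q_pochhammer q q k \<noteq> 0"
  shows "q_binom q k k * q_pochhammer (q^2) (q^2) k = q_pochhammer q (q^2) k * neg_poch q k ^ 2"
proof -
  have "q_pochhammer q q k * (q_binom q k k * q_pochhammer q q k) = q_pochhammer q q k * (q_pochhammer q (q^2) k * neg_poch q k)"
    using q_binom_pochhammer[of q k k] q_pochhammer_double[of q k]
    by (simp add: mult_2[symmetric] q_pochhammer_square mult_ac)
  with assms have "q_binom q k k * q_pochhammer q q k = q_pochhammer q (q^2) k * neg_poch q k" by simp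
  thus ?thesis unfolding q_pochhammer_square by (simp add: power2_eq_square)
qed

lemma q_pochhammer_X_nonzero: "q_pochhammer [:0,1:] [:0,1:] k \<noteq> (0 :: 'a::idom poly)"
proof -
  have "poly (q_pochhammer [:0,1:] [:0,1:] k) (0::'a) = 1"
    unfolding poly_q_pochhammer by (simp add: q_pochhammer_def)
  thus ?thesis by force
qed

lemma poly_q_binom: "poly (q_binom q k l) a = q_binom (poly q a) k l"
  by (induction q k l rule: q_binom.induct) simp_all

text \<open>Pochhammer symbols cannot be cancelled at a root of unity. The cancellation is done for
  the indeterminate, and the result is evaluated at \<open>q\<close>.\<close>

lemma q_binom_central_Suc:
  fixes q :: "'a::idom"
  shows "q_binom q (Suc k) (Suc k) * (1 - q ^ Suc k) = q_binom q k k * (1 - q^(2*k+1)) * (1 + q ^ Suc k)"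
proof -
  have *: "q_binom x (Suc k) (Suc k) * (1 - x ^ Suc k) = q_binom x k k * (1 - x^(2*k+1)) * (1 + x ^ Suc k)"
    if p: "q_pochhammer x x (Suc k) \<noteq> 0" for x :: "'a poly"
  proof -
    let ?p = "q_pochhammer x x"
    have d: "?p (k + k) = q_binom x k k * ?p k * ?p k" by (rule q_binom_pochhammer[symmetric])
    have f: "1 - x ^ Suc (Suc (k + k)) = (1 - x ^ Suc k) * (1 + x ^ Suc k)"
      by (simp add: algebra_simps power_add)
    have "(?p k * ?p (Suc k)) * (q_binom x (Suc k) (Suc k) * (1 - x ^ Suc k)) = q_binom x (Suc k) (Suc k) * ?p (Suc k) * ?p (Suc k)"
      unfolding q_pochhammer_q_Suc by (simp only: mult_ac)
    also have "\<dots> = ?p (k + k) * (1 - x ^ Suc (k + k)) * (1 - x ^ Suc (Suc (k + k)))"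
      unfolding q_binom_pochhammer by (simp add: q_pochhammer_Suc)
    also have "\<dots> = (?p k * ?p (Suc k)) * (q_binom x k k * (1 - x ^ Suc (k + k)) * (1 + x ^ Suc k))"
      unfolding d f q_pochhammer_q_Suc by (simp only: mult_ac)
    finally have "q_binom x (Suc k) (Suc k) * (1 - x ^ Suc k) = q_binom x k k * (1 - x ^ Suc (k + k)) * (1 + x ^ Suc k)"
      using p by (simp add: q_pochhammer_q_Suc)
    thus ?thesis by (simp add: mult_2)
  qed
  show ?thesis
    using arg_cong[OF *[OF q_pochhammer_X_nonzero], of "\<lambda>p. poly p q"]
    by (simp only: poly_mult poly_diff poly_add poly_power poly_q_binom) simp
qed

text \<open>
  The value of \<open>(q;q\<^sup>2)\<^sub>k / (q\<^sup>2;q\<^sup>2)\<^sub>k\<close> in a form that stays defined at roots of unity of odd order.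
\<close>

definition poch_ratio_value :: "'a::field \<Rightarrow> nat \<Rightarrow> 'a" where
  "poch_ratio_value q k = q_binom q k k / neg_poch q k ^ 2"

text \<open>If \<open>q^j = -1\<close>, raising to the odd power \<open>n\<close> would give
  \<open>1 = -1\<close>.\<close>

lemma neg_poch_nonzero:
  fixes q :: "'a::field_char_0"
  assumes "q^n = 1" "odd n"
  shows "neg_poch q k \<noteq> 0"
proof -
  have "1 + q^j \<noteq> 0" for j
  proof
    assume "1 + q^j = 0"
    hence "q^j = -1" by (simp add: add_eq_0_iff)
    hence "(q^n)^j = -1" using \<open>odd n\<close> by (metis power_commutes power_mult mult.commute power_minus_odd power_one)
    thus False using assms by simp
  qed
  thus ?thesis by (auto simp: neg_poch_def simp del: power_Suc)
qed

text \<open>Multiplied form of the recurrence \<open>poch_ratio_Suc\<close>, since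
  \<open>1 - q^(2*k+2)\<close> can vanish here.\<close>

lemma poch_ratio_value_Suc:
  fixes q :: "'a::field_char_0"
  assumes "q^n = 1" "odd n"
  shows "poch_ratio_value q (Suc k) * (1 - q^(2*k+2)) = poch_ratio_value q k * (1 - q^(2*k+1))"
proof -
  have n0: "neg_poch q k \<noteq> 0" "1 + q ^ Suc k \<noteq> 0"
    using neg_poch_nonzero[OF assms, of k] neg_poch_nonzero[OF assms, of "Suc k"] by (auto simp: neg_poch_def)
  have ns: "neg_poch q (Suc k) = neg_poch q k * (1 + q ^ Suc k)" by (simp add: neg_poch_def)
  have f: "1 - q^(2*k+2) = (1 - q ^ Suc k) * (1 + q ^ Suc k)"
    by (simp add: algebra_simps mult_2_right power_add)
  have "poch_ratio_value q (Suc k) * (1 - q^(2*k+2)) = (q_binom q (Suc k) (Suc k) * (1 - q ^ Suc k)) * (1 + q ^ Suc k) / neg_poch q (Suc k) ^ 2"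
    unfolding poch_ratio_value_def f by simp
  also have "\<dots> = poch_ratio_value q k * (1 - q^(2*k+1))"
    unfolding q_binom_central_Suc ns poch_ratio_value_def using n0 by (simp add: power2_eq_square del: power_Suc)
  finally show ?thesis .
qed

lemma sum_lessThan_add: "(\<Sum>k<a+b. f k) = (\<Sum>k<a. f k) + (\<Sum>r<b. f (a + r :: nat) :: 'a::comm_monoid_add)"
  by (induction b) (simp_all add: add.assoc)

text \<open>By periodicity the terms of each block are a common factor times the terms for
  \<open>r < d\<close>. A full block reduces to its first \<open>s + 1\<close> terms, as
  \<open>poch_ratio q r\<close> is zero beyond \<open>s\<close>; an incomplete last block consists
  of exactly these.\<close>

lemma block_sum:
  fixes q :: "'a::field_char_0"
  assumes qd: "q^d = 1" and d: "d = 2*s+1" and q1: "\<And>i. 0 < i \<Longrightarrow> i < d \<Longrightarrow> q^i \<noteq> 1" and "s > 0"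
    and t: "t = 0 \<or> t = s + 1"
  shows "(\<Sum>k<l*d+t. q_int q (4*k+1) * poch_ratio_value q k ^ 6 * q^k) = 0"
proof -
  define f where "f = (\<lambda>k. q_int q (4*k+1) * poch_ratio_value q k ^ 6 * q^k)"
  have "odd d" using d by simp
  have q: "1 - q \<noteq> 0" using q1[of 1] d \<open>s > 0\<close> by simp
  have per: "q^(i*d + r) = q^r" for i r
    using qd by (simp add: power_add mult.commute[of i] power_mult)
  have cv: "poch_ratio_value q (i*d + r) = poch_ratio_value q (i*d) * poch_ratio q r" if "r < d" for i r
    using that
  proof (induction r)
    case 0 thus ?case by (simp add: poch_ratio_def)
  next
    case (Suc r)
    have e: "q^(2*(i*d+r)+2) = q^(2*r+2)" "q^(2*(i*d+r)+1) = q^(2*r+1)"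
      using per[of "2*i" "2*r+2"] per[of "2*i" "2*r+1"] by (simp_all add: algebra_simps)
    have nz: "1 - q^(2*r+2) \<noteq> 0"
    proof
      assume "1 - q^(2*r+2) = 0"
      hence *: "q^(2*r+2) = 1" by simp
      show False
      proof (cases "2*r+2 < d")
        case True thus False using q1[of "2*r+2"] * by simp
      next
        case False
        \<comment> \<open>\<open>2*r+2\<close> is even and below \<open>2*d\<close>, so it differs
          from the odd \<open>d\<close>, and subtracting \<open>d\<close> leaves a positive exponent
          below \<open>d\<close>.\<close>
        hence "2*r+2 - d < d" "2*r+2-d > 0" "2*r+2 = 1*d + (2*r+2-d)" using Suc.prems d by presburger+
        thus False using q1[of "2*r+2-d"] * per[of 1 "2*r+2-d"] by metis
      qed
    qed
    have "poch_ratio_value q (Suc (i*d+r)) * (1 - q^(2*r+2)) = poch_ratio_value q (i*d) * poch_ratio q r * (1 - q^(2*r+1))"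
      using poch_ratio_value_Suc[OF qd \<open>odd d\<close>, of "i*d+r"] Suc unfolding e by simp
    hence "poch_ratio_value q (Suc (i*d+r)) = poch_ratio_value q (i*d) * (poch_ratio q r * (1 - q^(2*r+1)) / (1 - q^(2*r+2)))"
      using nz by (simp add: field_simps)
    thus ?case unfolding poch_ratio_Suc by simp
  qed
  have qi: "q_int q (4*(i*d+r)+1) = q_int q (4*r+1)" for i r
  proof -
    have "q^(4*(i*d+r)+1) = q^(4*r+1)" using per[of "4*i" "4*r+1"] by (simp add: algebra_simps)
    hence "(1 - q) * q_int q (4*(i*d+r)+1) = (1 - q) * q_int q (4*r+1)" by (simp only: q_int_mult)
    thus ?thesis using q by simp
  qed
  have fb: "f (i*d+r) = poch_ratio_value q (i*d) ^ 6 * (q_int q (4*r+1) * poch_ratio q r ^ 6 * q^r)" if "r < d" for i r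
    unfolding f_def qi cv[OF that] per by (simp add: power_mult_distrib)
  have half: "(\<Sum>r<s+1. q_int q (4*r+1) * poch_ratio q r ^ 6 * q^r) = 0"
    using half_sum_zero_6[OF qd d q1 \<open>s > 0\<close>] by (simp only: lessThan_Suc_atMost Suc_eq_plus1[symmetric])
  have cz: "poch_ratio q r = 0" if "r > s" for r
    using that
  proof (induction r)
    case (Suc r)
    show ?case
    proof (cases "r = s")
      case True
      thus ?thesis unfolding poch_ratio_Suc using qd d by simp
    next
      case False
      thus ?thesis unfolding poch_ratio_Suc using Suc by simp
    qed
  qed simp
  have full: "(\<Sum>r<d. q_int q (4*r+1) * poch_ratio q r ^ 6 * q^r) = 0"
  proof -
    have "(\<Sum>r<d. q_int q (4*r+1) * poch_ratio q r ^ 6 * q^r) = (\<Sum>r<s+1. q_int q (4*r+1) * poch_ratio q r ^ 6 * q^r)"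
      by (rule sum.mono_neutral_right) (auto simp: d cz)
    thus ?thesis using half by simp
  qed
  have blk: "(\<Sum>r<b. f (i*d+r)) = 0" if "b = d \<or> b = t" for i b
  proof -
    have "b \<le> d" using that t d by auto
    hence "(\<Sum>r<b. f (i*d+r)) = poch_ratio_value q (i*d) ^ 6 * (\<Sum>r<b. q_int q (4*r+1) * poch_ratio q r ^ 6 * q^r)"
      unfolding sum_distrib_left by (intro sum.cong refl fb) simp
    thus ?thesis using that t half full by auto
  qed
  have "(\<Sum>k<l*d. f k) = 0"
  proof (induction l)
    case (Suc l)
    thus ?case using sum_lessThan_add[of f "l*d" d] blk[of d l] by (simp add: add.commute)
  qed simp
  thus ?thesis using sum_lessThan_add[of f "l*d" t] blk[of t l] by (simp add: f_def)
qed

lemma poch_ratio_value_sum: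
  fixes z :: complex
  assumes zn: "z^n = 1" "z \<noteq> 1" and n: "n = 2*m+1" and M: "M = m \<or> M = n - 1"
  shows "(\<Sum>k\<le>M. q_int z (4*k+1) * poch_ratio_value z k ^ 6 * z^k) = 0"
proof -
  have "n > 0" using n by simp
  with zn roots_unity_eq_Union[of n] obtain d where d: "d dvd n" "z \<in> primitive_roots_unity d" by auto
  have "odd n" using n by simp
  then obtain s where s: "d = 2*s+1" using d(1) by (metis dvd_trans oddE)
  from d(1) obtain e where e: "n = d * e" by blast
  obtain f where f: "e = 2*f+1" using \<open>odd n\<close> e by (metis even_mult_iff oddE)
  have z1: "z^d = 1" "\<And>i. 0 < i \<Longrightarrow> i < d \<Longrightarrow> z^i \<noteq> 1"
    using d(2) by (auto simp: primitive_roots_unity_def)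
  have "s > 0" using z1(1) zn(2) s by (cases "s = 0") auto
  \<comment> \<open>From \<open>n = (2*s+1) * (2*f+1)\<close>: the long sum consists of
    \<open>e\<close> full blocks, the short one of \<open>f\<close> full blocks and a half
    block.\<close>
  have "M + 1 = e*d + 0 \<or> M + 1 = f*d + (s+1)"
    using M n e f s by (auto simp: algebra_simps)
  then obtain l t where lt: "M + 1 = l*d+t" "t = 0 \<or> t = s+1" by blast
  have "(\<Sum>k\<le>M. q_int z (4*k+1) * poch_ratio_value z k ^ 6 * z^k) = (\<Sum>k<l*d+t. q_int z (4*k+1) * poch_ratio_value z k ^ 6 * z^k)"
    unfolding lt(1)[symmetric] by (simp only: lessThan_Suc_atMost Suc_eq_plus1[symmetric])
  thus ?thesis using block_sum[OF z1(1) s z1(2) \<open>s > 0\<close> lt(2)] by simp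
qed

section \<open>From complex roots to divisibility in \<open>\<int>[q]\<close>\<close>

abbreviation cpoly :: "int poly \<Rightarrow> complex poly" where
  "cpoly \<equiv> map_poly of_int"

lemma cpoly_1: "cpoly 1 = 1" by simp

lemma cpoly_qX: "cpoly qX = [:0,1:]" by (simp add: qX_def map_poly_pCons)

lemma cpoly_diff: "cpoly (p - q) = cpoly p - cpoly q"
  by (rule poly_eqI) (simp add: coeff_map_poly)

lemma cpoly_power: "cpoly (p ^ k) = cpoly p ^ k"
  by (induction k) (simp_all add: of_int_poly_mult cpoly_1)

lemma cpoly_sum: "cpoly (\<Sum>x\<in>A. f x) = (\<Sum>x\<in>A. cpoly (f x))"
  by (induction A rule: infinite_finite_induct) (simp_all add: of_int_poly_add)

lemmas cpoly_simps = cpoly_1 cpoly_qX cpoly_diff cpoly_power cpoly_sum of_int_poly_add of_int_poly_mult of_int_poly_prod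

lemma cpoly_q_int: "cpoly (q_int q n) = q_int (cpoly q) n"
  by (simp add: q_int_def cpoly_simps)

lemma cpoly_q_pochhammer: "cpoly (q_pochhammer x p k) = q_pochhammer (cpoly x) (cpoly p) k"
  by (simp add: q_pochhammer_def cpoly_simps)

lemma cpoly_poch_tail: "cpoly (poch_tail q k m) = poch_tail (cpoly q) k m"
  by (simp add: poch_tail_def cpoly_simps del: power_Suc)

lemma cpoly_q_binom: "cpoly (q_binom q k l) = q_binom (cpoly q) k l"
  by (induction q k l rule: q_binom.induct) (simp_all add: cpoly_simps)

lemma cpoly_cleared_numer: "cpoly (cleared_numer q n m M N W) = cleared_numer (cpoly q) n m M (\<lambda>k. cpoly (N k)) (cpoly W)"
  by (simp add: cleared_numer_def cpoly_simps cpoly_q_int)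

lemma poly_cleared_numer: "poly (cleared_numer q n m M N W) a = cleared_numer (poly q a) n m M (\<lambda>k. poly (N k) a) (poly W a)"
  by (simp add: cleared_numer_def poly_sum poly_q_int)

section \<open>Rational functions in q and their numerators\<close>

lemma to_fract_power: "to_fract (x ^ k) = to_fract x ^ k"
  by (induction k) simp_all

lemma to_fract_prod: "to_fract (\<Prod>x\<in>A. f x) = (\<Prod>x\<in>A. to_fract (f x))"
  by (induction A rule: infinite_finite_induct) simp_all

lemma to_fract_q_int: "to_fract (q_int q n) = q_int (to_fract q) n"
  by (simp add: q_int_def to_fract_power)

lemma to_fract_q_pochhammer: "to_fract (q_pochhammer x p k) = q_pochhammer (to_fract x) (to_fract p) k"
  by (simp add: q_pochhammer_def to_fract_prod to_fract_power)

lemma qX_power: "i > 0 \<Longrightarrow> qX ^ i \<noteq> 1"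
proof
  assume "i > 0" "qX ^ i = 1"
  hence "poly (qX ^ i) 0 = poly 1 0" by simp
  thus False using \<open>i > 0\<close> by (simp add: qX_def power_0_left)
qed

lemma qvar_power: "i > 0 \<Longrightarrow> qvar ^ i \<noteq> 1"
  using qX_power[of i] by (metis qvar_def to_fract_power to_fract_1 to_fract_eq_iff)

lemma qvar_nonzero: "qvar \<noteq> 0"
  using qvar_power[of 1] by (simp add: qvar_def qX_def)

text \<open>The free upper limit \<open>M\<close> lets one definition serve both
  congruences.\<close>

definition diff_frac :: "nat \<Rightarrow> nat \<Rightarrow> int poly fract" where
  "diff_frac n M = (\<Sum>k=0..M. q_int qvar (4*k+1) *
              (q_pochhammer qvar (qvar^2) k ^ 6 / q_pochhammer (qvar^2) (qvar^2) k ^ 6) * qvar ^ k)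
           - (q_int qvar n * qvar powi ((1 - int n) div 2) *
              (\<Sum>k=0..(n-1) div 2.
                 (q_pochhammer qvar (qvar^2) k ^ 4 / q_pochhammer (qvar^2) (qvar^2) k ^ 4) * qvar ^ (2*k)))"

lemma diff_frac_cleared_numer:
  assumes n: "n = 2*m+1" and "m \<le> M" and W: "W \<noteq> 0"
    and N: "\<And>k. k \<le> M \<Longrightarrow> N k * q_pochhammer (qX^2) (qX^2) k = W * q_pochhammer qX (qX^2) k"
  shows "diff_frac n M * to_fract (qX^m * W^6) = to_fract (cleared_numer qX n m M N W)"
proof -
  define w where "w = to_fract W"
  have w0: "w \<noteq> 0" using W by (simp add: w_def)
  have c: "poch_ratio qvar k = to_fract (N k) / w" if "k \<le> M" for k
  proof -
    have "to_fract (N k) * q_pochhammer (qvar^2) (qvar^2) k = w * q_pochhammer qvar (qvar^2) k"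
      using arg_cong[OF N[OF that], of to_fract]
      by (simp add: to_fract_q_pochhammer to_fract_power w_def qvar_def)
    thus ?thesis using w0 q_pochhammer_nonzero(1)[OF qvar_power, of k] by (simp add: poch_ratio_def field_simps)
  qed
  have p: "qvar powi ((1 - int n) div 2) = 1 / qvar ^ m"
  proof -
    have "(1 - int n) div 2 = - int m" by (simp add: n)
    thus ?thesis by (simp add: power_int_minus inverse_eq_divide)
  qed
  have s6: "(\<Sum>k=0..M. q_int qvar (4*k+1) *
              (q_pochhammer qvar (qvar^2) k ^ 6 / q_pochhammer (qvar^2) (qvar^2) k ^ 6) * qvar ^ k)
    = (\<Sum>k\<le>M. q_int qvar (4*k+1) * to_fract (N k) ^ 6 * qvar ^ k) / w ^ 6"
    unfolding sum_divide_distrib atLeast0AtMost power_divide[symmetric] poch_ratio_def[symmetric]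
    by (intro sum.cong refl) (simp add: c power_divide)
  have s4: "(\<Sum>k=0..(n-1) div 2.
                 (q_pochhammer qvar (qvar^2) k ^ 4 / q_pochhammer (qvar^2) (qvar^2) k ^ 4) * qvar ^ (2*k))
    = (\<Sum>k\<le>m. to_fract (N k) ^ 4 * qvar ^ (2*k)) / w ^ 4"
    unfolding sum_divide_distrib atLeast0AtMost power_divide[symmetric] poch_ratio_def[symmetric]
    using \<open>m \<le> M\<close> by (intro sum.cong) (simp_all add: c power_divide n)
  have "(S / w^6 - i * (1 / qm) * (T / w^4)) * (qm * w^6) = qm * S - i * w^2 * T"
    if "qm \<noteq> 0" for S T i qm :: "int poly fract"
  proof -
    have w: "w^6 = w^4 * w^2" "w^4 \<noteq> 0" using w0 by (simp_all flip: power_add)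
    have "i * (1 / qm) * (T / a) * (qm * (a * b)) = i * b * T" if "a \<noteq> 0" for a b
      using that \<open>qm \<noteq> 0\<close> by simp
    from this[OF w(2), of "w^2"] have "i * (1 / qm) * (T / w^4) * (qm * w^6) = i * w^2 * T"
      by (simp only: w(1))
    thus ?thesis unfolding left_diff_distrib using w0 by simp
  qed
  from this[of "qvar^m"] show ?thesis
    unfolding diff_frac_def s6 s4 p cleared_numer_def
    using qvar_nonzero by (simp add: to_fract_power to_fract_q_int w_def qvar_def)
qed

text \<open>Carries zeros of any numerator \<open>c\<close> over to the reduced numerator, at points
  where \<open>d\<close> does not vanish.\<close>

lemma quot_of_fract_cross:
  assumes "x * to_fract d = to_fract c"
  shows "fst (quot_of_fract x) * d = c * snd (quot_of_fract x)"
proof -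
  let ?u = "fst (quot_of_fract x)" and ?v = "snd (quot_of_fract x)"
  have "x = Fraction_Field.Fract ?u ?v" by simp
  also have "\<dots> = to_fract ?u / to_fract ?v" by (rule Fract_conv_to_fract)
  finally have "x * to_fract ?v = to_fract ?u" by (simp add: field_simps)
  hence "to_fract (?u * d) = x * to_fract ?v * to_fract d" by (simp only: to_fract_mult)
  hence "to_fract (?u * d) = x * to_fract d * to_fract ?v" by (simp only: mult_ac)
  hence "to_fract (?u * d) = to_fract (c * ?v)" by (simp only: assms to_fract_mult)
  thus ?thesis by (simp only: to_fract_eq_iff)
qed

section \<open>Divisibility of polynomials through their complex roots\<close>

lemma linear_power_dvd_cancel:
  fixes p r :: "'a::idom poly"
  assumes "[:-z,1:]^k dvd r * p" "poly p z \<noteq> 0"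
  shows "[:-z,1:]^k dvd r"
proof (cases "r = 0")
  case False
  have "p \<noteq> 0" using assms(2) by auto
  hence "order z (r * p) = order z r" using False assms(2) by (simp add: order_mult order_0I)
  thus ?thesis using assms(1) False \<open>p \<noteq> 0\<close> by (simp add: order_divides)
qed simp

lemma complex_poly_dvdI_order:
  fixes p r :: "complex poly"
  assumes "p \<noteq> 0" "r \<noteq> 0" "\<And>z. order z p \<le> order z r"
  shows "p dvd r"
proof -
  have "proots p \<subseteq># proots r" using assms by (simp add: subseteq_mset_def)
  hence "(\<Prod>x\<in>#proots p. [:-x,1:]) dvd (\<Prod>x\<in>#proots r. [:-x,1:])"
    by (intro prod_mset_subset_imp_dvd image_mset_subseteq_mono)
  hence "smult (lead_coeff p) (\<Prod>x\<in>#proots p. [:-x,1:]) dvd smult (lead_coeff r) (\<Prod>x\<in>#proots r. [:-x,1:])"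
    using assms by (simp add: smult_dvd_iff dvd_smult)
  thus ?thesis by (simp add: complex_poly_decompose_multiset)
qed

text \<open>Division by a monic polynomial stays over the integers. The remainder is divisible by
  \<open>p\<close> over the complex numbers, so it is zero for reasons of degree.\<close>

lemma cpoly_dvd_imp_dvd:
  assumes "lead_coeff p = 1" "cpoly p dvd cpoly r"
  shows "p dvd r"
proof -
  have p0: "p \<noteq> 0" using assms(1) by auto
  obtain A R where AR: "pseudo_divmod r p = (A, R)" by (cases "pseudo_divmod r p")
  have eq: "r = p * A + R" and R: "R = 0 \<or> degree R < degree p"
    using pseudo_divmod[OF p0 AR] assms(1) by auto
  have "cpoly p dvd cpoly R"
    using assms(2) unfolding eq of_int_poly_add of_int_poly_mult by (simp add: dvd_add_right_iff)
  hence "R = 0"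
    using R dvd_imp_degree_le[of "cpoly p" "cpoly R"] of_int_poly_inj[of R 0]
    by (auto simp: degree_of_int_poly)
  thus ?thesis unfolding eq by simp
qed

lemma lead_coeff_cpoly: "lead_coeff (cpoly p) = of_int (lead_coeff p)"
  by (simp add: degree_of_int_poly coeff_map_poly)

text \<open>A zero factor would force \<open>n\<close> to divide \<open>2*(j+1)\<close>, hence
  \<open>j+1\<close> as \<open>n\<close> is odd, although \<open>j+1 \<le> M < n\<close>.\<close>

lemma q_pochhammer_root_nonzero:
  fixes z :: "'a::field"
  assumes "odd n" and z1: "\<And>i. 0 < i \<Longrightarrow> i < n \<Longrightarrow> z^i \<noteq> 1" and "z^n = 1" and "M < n"
  shows "q_pochhammer (z^2) (z^2) M \<noteq> 0"
proof -
  have "z^2 * (z^2)^j \<noteq> 1" if "j < M" for j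
  proof
    assume "z^2 * (z^2)^j = 1"
    hence *: "z^(2*(j+1)) = 1" by (simp add: square_power power2_eq_square mult_ac)
    have "z^((2*(j+1)) mod n) = 1"
    proof -
      have "z^(2*(j+1)) = z^(n * (2*(j+1) div n) + 2*(j+1) mod n)" by simp
      also have "\<dots> = z^((2*(j+1)) mod n)" by (simp only: power_add power_mult \<open>z^n = 1\<close>) simp
      finally show ?thesis using * by simp
    qed
    moreover have "(2*(j+1)) mod n < n" using \<open>M < n\<close> by simp
    ultimately have "n dvd 2*(j+1)" using z1 by (metis gr0I mod_0_imp_dvd)
    moreover have "coprime n 2" using \<open>odd n\<close> by simp
    ultimately have "n dvd j+1" by (simp only: coprime_dvd_mult_right_iff)
    thus False using that \<open>M < n\<close> by (auto dest: dvd_imp_le)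
  qed
  thus ?thesis by (auto simp: q_pochhammer_def)
qed

lemma poch_tail_split: "k \<le> m \<Longrightarrow> m \<le> M \<Longrightarrow> poch_tail q k M = poch_tail q k m * poch_tail q m M"
  unfolding poch_tail_def by (simp add: prod.atLeastLessThan_concat)

text \<open>Enlarging the common denominator multiplies the case \<open>M = m\<close> by
  \<open>B^6\<close>. Each added term, with \<open>k > m\<close>, contains the sixth power of
  \<open>1 - X^n\<close>, which vanishes at \<open>z\<close>.\<close>

lemma cleared_numer_cubic_root:
  fixes z :: complex
  assumes zn: "z^n = 1" and n: "n = 2*m+1" and z1: "\<And>i. 0 < i \<Longrightarrow> i < n \<Longrightarrow> z^i \<noteq> 1" and "m > 0"
    and M: "m \<le> M"
  defines "X \<equiv> [:0, 1::complex:]"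
  shows "[:-z,1:]^3 dvd cleared_numer X n m M (\<lambda>k. q_pochhammer X (X^2) k * poch_tail X k M) (q_pochhammer (X^2) (X^2) M)"
proof -
  define N where "N = (\<lambda>M k. q_pochhammer X (X^2) k * poch_tail X k M)"
  define W where "W = q_pochhammer (X^2) (X^2)"
  define B where "B = poch_tail X m M"
  have z0: "z \<noteq> 0" using zn n by auto
  have "[:-z,1:]^3 dvd cleared_numer X n m m (N m) (W m) * X^(2*n*m)"
    using bivar_cubic_root[OF zn n z1 \<open>m > 0\<close>] unfolding bivar_0 X_def N_def W_def by (simp add: mult.commute)
  hence d1: "[:-z,1:]^3 dvd cleared_numer X n m m (N m) (W m)"
    by (rule linear_power_dvd_cancel) (simp add: X_def z0)
  have NM: "N M k = N m k * B" if "k \<le> m" for k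
    unfolding N_def B_def poch_tail_split[OF that M] by (simp only: mult_ac)
  have WM: "W M = W m * B"
    unfolding W_def B_def by (rule q_pochhammer_poch_tail[OF M, symmetric])
  define R where "R = (\<Sum>k\<in>{m+1..M}. q_int X (4*k+1) * N M k ^ 6 * X^k)"
  have "{..M} = {..m} \<union> {m+1..M}" using M by auto
  hence s6: "(\<Sum>k\<le>M. q_int X (4*k+1) * N M k ^ 6 * X^k) = B^6 * (\<Sum>k\<le>m. q_int X (4*k+1) * N m k ^ 6 * X^k) + R"
    unfolding R_def sum_distrib_left
    by (simp only:) (subst sum.union_disjoint; auto simp: NM power_mult_distrib intro!: sum.cong)
  have s4: "(\<Sum>k\<le>m. N M k ^ 4 * X^(2*k)) = B^4 * (\<Sum>k\<le>m. N m k ^ 4 * X^(2*k))"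
    unfolding sum_distrib_left by (intro sum.cong) (auto simp: NM power_mult_distrib)
  have "B^6 = B^2 * B^4" by (simp flip: power_add)
  hence num: "cleared_numer X n m M (N M) (W M) = B^6 * cleared_numer X n m m (N m) (W m) + X^m * R"
    unfolding cleared_numer_def s6 s4 WM by (simp add: algebra_simps power_mult_distrib)
  have "[:-z,1:]^3 dvd R"
    unfolding R_def
  proof (rule dvd_sum)
    fix k assume k: "k \<in> {m+1..M}"
    have "poly (N M k) z = 0"
      unfolding N_def poly_mult poly_q_pochhammer
      using k zn by (subst q_pochhammer_eq_0[of m]) (auto simp: X_def power2_power n)
    hence "[:-z,1:] dvd N M k" by (simp add: poly_eq_0_iff_dvd)
    hence "[:-z,1:]^6 dvd N M k ^ 6" by (rule dvd_power_same)
    moreover have "[:-z,1:]^3 dvd [:-z,1:]^6" by (rule le_imp_power_dvd) simp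
    ultimately have "[:-z,1:]^3 dvd N M k ^ 6" by (rule dvd_trans[rotated])
    thus "[:-z,1:]^3 dvd q_int X (4*k+1) * N M k ^ 6 * X^k" by (intro dvd_mult2[OF dvd_mult])
  qed
  with d1 show ?thesis unfolding N_def[symmetric] W_def[symmetric]
    using num by (simp add: N_def)
qed

text \<open>The common denominator \<open>W\<close> is nonzero at \<open>z\<close> because
  \<open>M < n\<close>, so the triple root passes to the reduced numerator.\<close>

lemma diff_frac_cubic_root:
  fixes z :: complex
  assumes zn: "z^n = 1" and n: "n = 2*m+1" and z1: "\<And>i. 0 < i \<Longrightarrow> i < n \<Longrightarrow> z^i \<noteq> 1" and "m > 0"
    and M: "m \<le> M" "M < n"
  shows "[:-z,1:]^3 dvd cpoly (fst (quot_of_fract (diff_frac n M)))"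
proof -
  define N where "N = (\<lambda>k. q_pochhammer qX (qX^2) k * poch_tail qX k M)"
  define W where "W = q_pochhammer (qX^2) (qX^2) M"
  let ?u = "fst (quot_of_fract (diff_frac n M))" and ?v = "snd (quot_of_fract (diff_frac n M))"
  have z0: "z \<noteq> 0" using zn n by auto
  have Wz: "poly (cpoly W) z \<noteq> 0"
    using q_pochhammer_root_nonzero[OF _ z1 zn M(2)] n
    by (simp add: W_def cpoly_q_pochhammer poly_q_pochhammer cpoly_power cpoly_qX)
  hence W: "W \<noteq> 0" by auto
  have "N k * q_pochhammer (qX^2) (qX^2) k = W * q_pochhammer qX (qX^2) k" if "k \<le> M" for k
    unfolding N_def W_def q_pochhammer_poch_tail[OF that, symmetric] by (simp only: mult_ac)
  from diff_frac_cleared_numer[OF n M(1) W this]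
  have "?u * (qX^m * W^6) = cleared_numer qX n m M N W * ?v" by (rule quot_of_fract_cross)
  from arg_cong[OF this, of cpoly]
  have "cpoly ?u * cpoly (qX^m * W^6) = cpoly (cleared_numer qX n m M N W) * cpoly ?v"
    by (simp only: of_int_poly_mult)
  moreover have "[:-z,1:]^3 dvd cpoly (cleared_numer qX n m M N W)"
    using cleared_numer_cubic_root[OF zn n z1 \<open>m > 0\<close> M(1)]
    by (simp add: cpoly_cleared_numer N_def W_def cpoly_simps cpoly_q_pochhammer cpoly_poch_tail)
  ultimately have "[:-z,1:]^3 dvd cpoly ?u * cpoly (qX^m * W^6)" by simp
  thus ?thesis
    by (rule linear_power_dvd_cancel) (use Wz z0 in \<open>simp add: of_int_poly_mult cpoly_power cpoly_qX\<close>)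
qed

text \<open>The order of \<open>z\<close> may be smaller than \<open>n\<close>, and Pochhammer
  denominators may then vanish at \<open>z\<close>. Hence the common denominator
  \<open>neg_poch qX M ^ 2\<close>, which does not.\<close>

lemma diff_frac_root:
  fixes z :: complex
  assumes zn: "z^n = 1" "z \<noteq> 1" and n: "n = 2*m+1" and M: "M = m \<or> M = n - 1"
  shows "poly (cpoly (fst (quot_of_fract (diff_frac n M)))) z = 0"
proof -
  define T where "T = (\<lambda>k. \<Prod>j\<in>{k..<M}. 1 + qX ^ Suc j)"
  define N where "N = (\<lambda>k. q_binom qX k k * T k ^ 2)"
  define W where "W = neg_poch qX M ^ 2"
  let ?u = "fst (quot_of_fract (diff_frac n M))" and ?v = "snd (quot_of_fract (diff_frac n M))"
  have z0: "z \<noteq> 0" using zn n by (auto simp: power_0_left)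
  have "odd n" "m \<le> M" using n M by auto
  have T: "neg_poch qX k * T k = neg_poch qX M" if "k \<le> M" for k
    unfolding neg_poch_def T_def by (rule prod_lessThan_split[OF that])
  have cneg: "cpoly (neg_poch qX k) = neg_poch [:0,1:] k" for k by (simp add: neg_poch_def cpoly_simps del: power_Suc)
  have pneg: "poly (cpoly (neg_poch qX k)) z = neg_poch z k" for k
    unfolding cneg by (simp add: neg_poch_def poly_prod del: power_Suc)
  have nz: "neg_poch z k \<noteq> 0" for k by (rule neg_poch_nonzero[OF zn(1) \<open>odd n\<close>])
  have W: "W \<noteq> 0" using pneg[of M] nz[of M] by (auto simp: W_def)
  have Wz: "poly (cpoly W) z \<noteq> 0" using pneg[of M] nz[of M] by (simp add: W_def cpoly_power)
  have "N k * q_pochhammer (qX^2) (qX^2) k = W * q_pochhammer qX (qX^2) k" if "k \<le> M" for k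
  proof -
    have "q_binom qX k k * q_pochhammer (qX^2) (qX^2) k = q_pochhammer qX (qX^2) k * neg_poch qX k ^ 2"
      by (rule q_binom_central) (simp add: qX_def q_pochhammer_X_nonzero)
    hence "N k * q_pochhammer (qX^2) (qX^2) k = (neg_poch qX k * T k)^2 * q_pochhammer qX (qX^2) k"
      by (simp add: N_def power_mult_distrib mult_ac)
    thus ?thesis unfolding T[OF that] W_def .
  qed
  from diff_frac_cleared_numer[OF n \<open>m \<le> M\<close> W this]
  have "?u * (qX^m * W^6) = cleared_numer qX n m M N W * ?v" by (rule quot_of_fract_cross)
  from arg_cong[OF this, of "\<lambda>p. poly (cpoly p) z"]
  have *: "poly (cpoly ?u) z * (z^m * poly (cpoly W) z ^ 6) = poly (cpoly (cleared_numer qX n m M N W)) z * poly (cpoly ?v) z"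
    by (simp add: of_int_poly_mult cpoly_power cpoly_qX)
  have Nz: "poly (cpoly (N k)) z = poly (cpoly W) z * poch_ratio_value z k" if "k \<le> M" for k
  proof -
    have "neg_poch z k * poly (cpoly (T k)) z = neg_poch z M"
      using arg_cong[OF T[OF that], of "\<lambda>p. poly (cpoly p) z"] by (simp add: of_int_poly_mult pneg)
    hence "poly (cpoly (T k)) z = neg_poch z M / neg_poch z k" using nz[of k] by (simp add: field_simps)
    thus ?thesis
      by (simp add: N_def W_def poch_ratio_value_def of_int_poly_mult cpoly_power pneg cpoly_q_binom cpoly_qX poly_q_binom power_divide)
  qed
  have "(1 - z) * q_int z n = 0" by (simp only: q_int_mult zn) simp
  hence qi: "q_int z n = 0" using zn(2) by simp
  have "poly (cpoly (cleared_numer qX n m M N W)) z = z^m * (\<Sum>k\<le>M. q_int z (4*k+1) * poly (cpoly (N k)) z ^ 6 * z^k)"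
    by (simp add: cpoly_cleared_numer poly_cleared_numer cpoly_qX) (simp add: cleared_numer_def qi)
  also have "(\<Sum>k\<le>M. q_int z (4*k+1) * poly (cpoly (N k)) z ^ 6 * z^k) = poly (cpoly W) z ^ 6 * (\<Sum>k\<le>M. q_int z (4*k+1) * poch_ratio_value z k ^ 6 * z^k)"
    unfolding sum_distrib_left by (intro sum.cong refl) (simp add: Nz power_mult_distrib)
  also have "\<dots> = 0" using poch_ratio_value_sum[OF zn n M] by simp
  finally show ?thesis using * Wz z0 by simp
qed

lemma order_X_power_minus_1: "n > 0 \<Longrightarrow> order z ([:0,1:]^n - 1 :: complex poly) \<le> 1"
proof (rule ccontr)
  let ?p = "[:0,1:]^n - 1 :: complex poly"
  assume n: "n > 0" and "\<not> order z ?p \<le> 1"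
  hence "[:-z,1:]^2 dvd ?p" by (simp add: order_divides)
  then obtain s where s: "?p = [:-z,1:]^2 * s" by blast
  have "poly ?p z = 0" unfolding s by simp
  hence zn: "z^n = 1" by simp
  have "poly (pderiv ?p) z = 0" unfolding s by (simp add: pderiv_mult pderiv_power)
  hence "of_nat n * z^(n-1) = 0" using n by (simp add: pderiv_diff pderiv_power pderiv_pCons)
  hence "z = 0" using n by simp
  with zn n show False by (simp add: power_0_left)
qed

text \<open>Compares orders of vanishing. The modulus has order at most 1 + 2 at a primitive
  \<open>n\<close>-th root of unity, at most 1 at the other zeros of [n], and 0 elsewhere. Being
  monic, it then divides over the integers too.\<close>

lemma modulus_dvd:
  assumes n: "n = 2*m+1" and "m > 0" and M: "M = m \<or> M = n - 1"
  shows "q_int qX n * cyclotomic_poly n ^ 2 dvd fst (quot_of_fract (diff_frac n M))"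
proof -
  let ?u = "fst (quot_of_fract (diff_frac n M))"
  define X where "X = [:0, 1::complex:]"
  define Q where "Q = q_int X n"
  define C where "C = (\<Prod>z\<in>primitive_roots_unity n. [:-z,1:])"
  have n0: "n > 0" "n > 1" using n \<open>m > 0\<close> by auto
  have fin: "finite (primitive_roots_unity n)" by (rule finite_primitive_roots_unity[OF n0(1)])
  have P: "cpoly (q_int qX n * cyclotomic_poly n ^ 2) = Q * C^2"
    by (simp add: of_int_poly_mult cpoly_power cpoly_q_int cpoly_qX of_int_cyclotomic_poly[OF n0(1)] Q_def C_def X_def)
  have XQ: "[:-1,1:] * Q = X^n - 1"
  proof -
    have "(1 - X) * Q = 1 - X^n" unfolding Q_def by (rule q_int_mult)
    moreover have "[:-1,1:] = - (1 - X)" by (simp add: X_def one_pCons)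
    ultimately show ?thesis by (simp only: mult_minus_left) simp
  qed
  have Xn: "X^n - 1 = monom 1 n - 1" by (simp add: X_def monom_altdef)
  have dXn: "degree (monom 1 n - 1 :: complex poly) = n"
    using n0 by (intro antisym degree_le le_degree) auto
  have "lead_coeff ([:-1,1:] * Q) = 1" unfolding XQ Xn using dXn n0 by simp
  hence lQ: "lead_coeff Q = 1" unfolding lead_coeff_mult by simp
  have lC: "lead_coeff C = 1" unfolding C_def by (simp add: lead_coeff_prod)
  have lP: "lead_coeff (Q * C^2) = 1" by (simp only: lead_coeff_mult lead_coeff_power lQ lC) simp
  have Q0: "Q \<noteq> 0" and C0: "C \<noteq> 0" using lQ lC by auto
  have "lead_coeff (q_int qX n * cyclotomic_poly n ^ 2) = 1"
    using lP unfolding P[symmetric] lead_coeff_cpoly by simp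
  moreover have "Q * C^2 dvd cpoly ?u"
  proof (cases "cpoly ?u = 0")
    case False
    show ?thesis
    proof (rule complex_poly_dvdI_order)
      fix z :: complex
      have "order z ([:-1,1:] * Q) \<le> 1"
        unfolding XQ unfolding X_def by (rule order_X_power_minus_1[OF n0(1)])
      moreover have "order z Q \<le> order z ([:-1,1:] * Q)"
      proof (rule dvd_imp_order_le)
        show "[:-1,1:] * Q \<noteq> 0" unfolding mult_eq_0_iff using Q0 by simp
      qed (rule dvd_triv_right)
      ultimately have oQ: "order z Q \<le> 1" by linarith
      have oC: "order z C = (if z \<in> primitive_roots_unity n then 1 else 0)"
      proof -
        have "proots C = mset_set (primitive_roots_unity n)"
          unfolding C_def by (subst proots_prod) auto
        moreover have "order z C = count (proots C) z" using C0 by simp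
        ultimately show ?thesis using fin by (simp only: count_mset_set') simp
      qed
      have oP: "order z (Q * C^2) = order z Q + 2 * order z C"
        using Q0 C0 by (simp add: order_mult power2_eq_square)
      show "order z (Q * C^2) \<le> order z (cpoly ?u)"
      proof (cases "z \<in> primitive_roots_unity n")
        case True
        hence z: "z^n = 1" "\<And>i. 0 < i \<Longrightarrow> i < n \<Longrightarrow> z^i \<noteq> 1" by (auto simp: primitive_roots_unity_def)
        have "m \<le> M" "M < n" using M n by auto
        from diff_frac_cubic_root[OF z(1) n z(2) \<open>m > 0\<close> this] False
        have "3 \<le> order z (cpoly ?u)" by (simp add: order_divides)
        thus ?thesis using oP oQ oC True by simp
      next
        case nprim: False
        show ?thesis
        proof (cases "poly Q z = 0")
          case True
          have "poly (X^n - 1) z = 0" unfolding XQ[symmetric] using True by simp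
          hence "z^n = 1" by (simp add: X_def)
          \<comment> \<open>At 1 the q-integer takes the nonzero value \<open>n\<close>.\<close>
          moreover have "z \<noteq> 1"
          proof
            assume "z = 1"
            hence "poly Q z = of_nat n" by (simp add: Q_def poly_q_int X_def) (simp add: q_int_def)
            with True n0 show False by simp
          qed
          ultimately have "poly (cpoly ?u) z = 0" using diff_frac_root[OF _ _ n M] by blast
          hence "order z (cpoly ?u) \<noteq> 0" using False by (simp add: order_root)
          thus ?thesis using oP oQ oC nprim by simp
        next
          case f: False
          thus ?thesis using oP oC nprim by (simp add: order_0I)
        qed
      qed
    qed (use False Q0 C0 in auto)
  qed simp
  ultimately show ?thesis by (intro cpoly_dvd_imp_dvd) (simp_all only: P)
qed

text \<open>The case \<open>n = 1\<close> stands apart because \<open>1 - q\<close> vanishes at the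
  only root of the first cyclotomic polynomial; here both sides are equal to 1.\<close>

lemma diff_frac_1: "diff_frac 1 0 = 0"
  by (simp add: diff_frac_def q_int_def)

lemma diff_frac_dvd:
  assumes "odd n" and M: "M = (n-1) div 2 \<or> M = n - 1"
  shows "q_int qX n * cyclotomic_poly n ^ 2 dvd fst (quot_of_fract (diff_frac n M))"
proof (cases "n = 1")
  case True
  thus ?thesis using M diff_frac_1 by auto
next
  case False
  define m where "m = (n-1) div 2"
  have n: "n = 2*m+1" using \<open>odd n\<close> by (simp add: m_def)
  hence "m > 0" using False by simp
  moreover have "M = m \<or> M = n - 1" using M unfolding m_def .
  ultimately show ?thesis by (rule modulus_dvd[OF n])
qed

theorem theorem2p1:
  fixes n :: nat
  assumes "n > 0" and "odd n"
  shows "(ratfun_cong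
           (\<Sum>k=0..n-1. q_int qvar (4*k+1) *
              (q_pochhammer qvar (qvar^2) k ^ 6 / q_pochhammer (qvar^2) (qvar^2) k ^ 6) * qvar ^ k)
           (q_int qvar n * qvar powi ((1 - int n) div 2) *
              (\<Sum>k=0..(n-1) div 2.
                 (q_pochhammer qvar (qvar^2) k ^ 4 / q_pochhammer (qvar^2) (qvar^2) k ^ 4) * qvar ^ (2*k)))
           (q_int qX n * cyclotomic_poly n ^ 2))
     \<and> (ratfun_cong
           (\<Sum>k=0..(n-1) div 2. q_int qvar (4*k+1) *
              (q_pochhammer qvar (qvar^2) k ^ 6 / q_pochhammer (qvar^2) (qvar^2) k ^ 6) * qvar ^ k)
           (q_int qvar n * qvar powi ((1 - int n) div 2) *
              (\<Sum>k=0..(n-1) div 2.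
                 (q_pochhammer qvar (qvar^2) k ^ 4 / q_pochhammer (qvar^2) (qvar^2) k ^ 4) * qvar ^ (2*k)))
           (q_int qX n * cyclotomic_poly n ^ 2))"
  unfolding ratfun_cong_def diff_frac_def[symmetric]
  by (intro conjI diff_frac_dvd \<open>odd n\<close>) simp_all

end
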